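(* Let $\Sigma_1$ and $\Sigma_2$ be entire spacelike hypersurfaces in $\mathbb R^{n,1}$. Suppose that $\Sigma_1$ has mean curvature bounded below by $H_1>0$, that $\Sigma_2$ has constant mean curvature $H_2$, and that $H_1\ge H_2$. Suppose also that $\Sigma_2\subset\mathcal D(\Sigma_1)$. Then $\Sigma_2\subset J^+(\Sigma_1)$.
   Context: Minkowski space $\mathbb R^{n,1}$ ($n\ge 1$) is $\mathbb R^{n+1}$ with $\langle\cdot,\cdot\rangle=dx_1^2+\dots+dx_n^2-dx_{n+1}^2$. A vector $v$ is spacelike, timelike or null if $\langle v,v\rangle$ is positive, negative or zero; future-directed means positive last coordinate. $J^+(X)$ is the set of points $p+v$ with $p\in X$ and $v$ zero or a future-directed timelike or null vector. A spacelike hypersurface is a smooth connected hypersurface on which the induced metric is Riemannian; it is entire if it is the graph $\{x_{n+1}=f(x_1,\dots,x_n)\}$ of a function $f:\mathbb R^n\to\mathbb R$. The mean curvature is $\frac1n\mathrm{tr}(d\nu)$, where $\nu$ is the future-directed unit normal (so the future unit hyperboloid has mean curvature $1$). A causal curve is a $C^0$ curve each pair of points of which is timelike- or null-separated; it is inextendable if it is globally the graph $\{(\gamma(t),t)\}$ of a $1$-Lipschitz function $\gamma:\mathbb R\to\mathbb R^n$. The domain of dependence $\mathcal D(\Sigma)$ is the set of points $p$ such that every inextendable causal curve through $p$ meets $\Sigma$. *)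

theory Defs
  imports "HOL-Analysis.Analysis"
begin

section \<open>Smooth maps and smooth hypersurfaces of a Euclidean space\<close>

text \<open>Meant for open sets \<open>U\<close>.  In finite dimension, controlling all directional derivatives
  \<open>x \<mapsto> Df(x) v\<close> is the same as controlling the total derivative.\<close>

primrec Ck_on ::
    "nat \<Rightarrow> 'a::euclidean_space set \<Rightarrow> ('a \<Rightarrow> 'b::real_normed_vector) \<Rightarrow> bool" where
  "Ck_on 0 U f \<longleftrightarrow> continuous_on U f"
| "Ck_on (Suc k) U f \<longleftrightarrow>
     (\<forall>x\<in>U. f differentiable (at x)) \<and>
     (\<forall>v. Ck_on k U (\<lambda>x. frechet_derivative f (at x) v))"

definition smooth_on :: "'a::euclidean_space set \<Rightarrow> ('a \<Rightarrow> 'b::real_normed_vector) \<Rightarrow> bool" where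
  "smooth_on U f \<longleftrightarrow> (\<forall>k. Ck_on k U f)"

text \<open>Embedded hypersurfaces: locally regular level sets of smooth functions.\<close>

definition smooth_hypersurface :: "'a::euclidean_space set \<Rightarrow> bool" where
  "smooth_hypersurface S \<longleftrightarrow>
     (\<forall>p\<in>S. \<exists>U (\<phi> :: 'a \<Rightarrow> real). open U \<and> p \<in> U \<and> smooth_on U \<phi> \<and>
        S \<inter> U = {q \<in> U. \<phi> q = 0} \<and>
        (\<forall>q\<in>S \<inter> U. frechet_derivative \<phi> (at q) \<noteq> (\<lambda>v. 0)))"

text \<open>Initial velocities of smooth curves running in \<open>S\<close>.\<close>

definition tangent_space :: "'a::euclidean_space set \<Rightarrow> 'a \<Rightarrow> 'a set" where
  "tangent_space S p =
     {v. \<exists>\<epsilon> > 0. \<exists>c :: real \<Rightarrow> 'a.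
        smooth_on {-\<epsilon><..<\<epsilon>} c \<and> c ` {-\<epsilon><..<\<epsilon>} \<subseteq> S \<and>
        c 0 = p \<and> (c has_vector_derivative v) (at 0)}"

text \<open>Trace of an endomorphism \<open>L\<close> of a linear subspace \<open>V\<close>: the sum of the diagonal matrix
  entries in a basis of \<open>V\<close>.  The value does not depend on the chosen basis.\<close>

definition trace_on :: "'a::euclidean_space set \<Rightarrow> ('a \<Rightarrow> 'a) \<Rightarrow> real" where
  "trace_on V L =
     (let B = (SOME B. B \<subseteq> V \<and> independent B \<and> V \<subseteq> span B)
      in \<Sum>b\<in>B. representation B (L b) b)"

section \<open>Minkowski space\<close>

text \<open>The first component holds the coordinates \<open>x\<^sub>1, \<dots>, x\<^sub>n\<close> with \<open>n = CARD('n) \<ge> 1\<close>,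
  the second one is \<open>x\<^sub>n\<^sub>+\<^sub>1\<close>.\<close>

type_synonym 'n minkowski = "(real ^ 'n) \<times> real"

definition mink :: "'n::finite minkowski \<Rightarrow> 'n minkowski \<Rightarrow> real" where
  "mink v w = fst v \<bullet> fst w - snd v * snd w"

definition spacelike :: "'n::finite minkowski \<Rightarrow> bool" where
  "spacelike v \<longleftrightarrow> mink v v > 0"

definition timelike :: "'n::finite minkowski \<Rightarrow> bool" where
  "timelike v \<longleftrightarrow> mink v v < 0"

definition null_vector :: "'n::finite minkowski \<Rightarrow> bool" where
  "null_vector v \<longleftrightarrow> mink v v = 0"

definition future_directed :: "'n::finite minkowski \<Rightarrow> bool" where
  "future_directed v \<longleftrightarrow> snd v > 0"

definition causal_future :: "'n::finite minkowski set \<Rightarrow> 'n minkowski set" where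
  "causal_future X =
     {p + v | p v. p \<in> X \<and>
        (v = 0 \<or> future_directed v \<and> (timelike v \<or> null_vector v))}"

section \<open>Spacelike hypersurfaces and their mean curvature\<close>

text \<open>The induced metric is automatically smooth and symmetric, so that being Riemannian
  amounts to positive definiteness on each tangent space.\<close>

definition spacelike_hypersurface :: "'n::finite minkowski set \<Rightarrow> bool" where
  "spacelike_hypersurface S \<longleftrightarrow>
     smooth_hypersurface S \<and> connected S \<and>
     (\<forall>p\<in>S. \<forall>v\<in>tangent_space S p. v \<noteq> 0 \<longrightarrow> spacelike v)"

definition entire :: "'n::finite minkowski set \<Rightarrow> bool" where
  "entire S \<longleftrightarrow> (\<exists>f :: real ^ 'n \<Rightarrow> real. S = {(x, t). t = f x})"

definition future_unit_normal :: "'n::finite minkowski set \<Rightarrow> 'n minkowski \<Rightarrow> 'n minkowski" where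
  "future_unit_normal S p =
     (THE \<nu>. mink \<nu> \<nu> = -1 \<and> future_directed \<nu> \<and> (\<forall>v\<in>tangent_space S p. mink \<nu> v = 0))"

text \<open>The derivative of the normal is taken within \<open>S\<close>.  As a linear map on the ambient space
  it is not unique, but its restriction to the tangent space, which is all that enters
  the trace, is.\<close>

definition mean_curvature :: "'n::finite minkowski set \<Rightarrow> 'n minkowski \<Rightarrow> real" where
  "mean_curvature S p =
     trace_on (tangent_space S p) (frechet_derivative (future_unit_normal S) (at p within S))
       / real CARD('n)"

section \<open>Causal curves and domains of dependence\<close>

definition causal_curve :: "'n::finite minkowski set \<Rightarrow> bool" where
  "causal_curve C \<longleftrightarrow>
     (\<exists>I (c :: real \<Rightarrow> 'n minkowski). is_interval I \<and> continuous_on I c \<and> C = c ` I) \<and>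
     (\<forall>p\<in>C. \<forall>q\<in>C. p \<noteq> q \<longrightarrow> timelike (q - p) \<or> null_vector (q - p))"

definition inextendable_causal_curve :: "'n::finite minkowski set \<Rightarrow> bool" where
  "inextendable_causal_curve C \<longleftrightarrow>
     causal_curve C \<and>
     (\<exists>\<gamma> :: real \<Rightarrow> real ^ 'n. 1-lipschitz_on UNIV \<gamma> \<and> C = range (\<lambda>t. (\<gamma> t, t)))"

definition domain_of_dependence :: "'n::finite minkowski set \<Rightarrow> 'n minkowski set" where
  "domain_of_dependence S =
     {p. \<forall>C. inextendable_causal_curve C \<and> p \<in> C \<longrightarrow> C \<inter> S \<noteq> {}}"

end

theory Submission
  imports Defs
begin

text \<open>Write \<open>\<Sigma>\<^sub>i\<close> as the graph of \<open>f\<^sub>i\<close>.  Both functions are strictly \<open>1\<close>-Lipschitz, and the assertion is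
  that \<open>f\<^sub>1 \<le> f\<^sub>2\<close>.  Suppose that \<open>f\<^sub>2(x\<^sub>0) < f\<^sub>1(x\<^sub>0)\<close>.  The idea is to look at the Lorentzian distance from
  points \<open>p \<in> \<Sigma>\<^sub>2\<close> to points \<open>q \<in> \<Sigma>\<^sub>1\<close> in their future.  If the distance \<open>\<tau>\<close> had a maximum, the segment
  from \<open>p\<close> to \<open>q\<close> would be normal to both hypersurfaces, and moving \<open>p\<close> and \<open>q\<close> along corresponding
  orthonormal directions, those at \<open>q\<close> dilated by a factor \<open>l\<close>, the trace of the second variation of
  the squared distance would be \<open>2n\<tau>(l\<^sup>2 H(q) - H\<^sub>2) - 2n(l - 1)\<^sup>2\<close>.  As \<open>H(q) \<ge> H\<^sub>1 \<ge> H\<^sub>2\<close> and \<open>H\<^sub>1 > 0\<close>,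
  this is positive for \<open>l\<close> slightly larger than \<open>1\<close>, a contradiction.

  The hypersurface \<open>\<Sigma>\<^sub>2\<close> is not compact, so the squared distance is penalised by
  \<open>\<epsilon> log (1 + z)\<close>, where \<open>z\<close> is the Minkowski square of the separation from the point of \<open>\<Sigma>\<^sub>2\<close>
  above \<open>x\<^sub>0\<close>.  Three facts make a maximum exist.  First, \<open>z\<close> grows at least linearly (\<open>z_proper\<close>).  Secondly,
  \<open>\<tau> \<le> 1/H\<^sub>1\<close>, which is the focusing of the past normals of \<open>\<Sigma>\<^sub>1\<close> (\<open>timelike_separation_le\<close>).  Thirdly,
  the part of \<open>\<Sigma>\<^sub>1\<close> in the future of a compact part of \<open>\<Sigma>\<^sub>2\<close> is bounded, since otherwise a null ray
  would escape below \<open>\<Sigma>\<^sub>1\<close> and \<open>\<Sigma>\<^sub>2\<close> would leave the domain of dependence (\<open>cone_bounded\<close>).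

  At the maximum of the penalised function (\<open>penalised_maximum\<close>) the normals \<open>\<nu>\<close> and \<open>N\<close> at \<open>p\<close> and
  \<open>q\<close> are no longer equal.  The frames are matched by the boost from \<open>\<nu>\<close> to \<open>N\<close>, and the tilt
  \<open>c = -\<langle>\<nu>, N\<rangle> \<ge> 1\<close> enters the trace of the second variation (\<open>trace_of_second_variation\<close>).
  The penalty contributes an unbounded term to this trace, a multiple of \<open>H\<^sub>2 \<omega>\<close> for the normal
  component \<open>\<omega>\<close> of the position vector.  The concavity of the logarithm supplies a positive multiple
  of \<open>\<omega>\<^sup>2\<close>, and the same term, which equals \<open>4\<tau>\<^sup>2(c\<^sup>2 - 1)/\<epsilon>\<close> by the first variation, also
  outweighs the tilt.  What remains of the penalty is
  of order \<open>\<epsilon>\<close>, and the contradiction persists (\<open>comparison_arithmetic\<close>).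

  To connect this with the definitions, an entire spacelike hypersurface is shown to be the graph of
  a smooth function by an implicit function theorem (\<open>spacelike_graph_smooth\<close>), and its mean curvature
  is computed in an arbitrary orthonormal frame (\<open>mean_curvature_eq_sum\<close>).\<close>

section \<open>Calculus of \<open>C\<^sup>k\<close> maps\<close>

lemma Ck_on_cong:
  assumes "open U" "\<And>x. x \<in> U \<Longrightarrow> f x = g x" "Ck_on k U f"
  shows "Ck_on k U g"
  using assms(2,3)
proof (induction k arbitrary: f g)
  case 0
  then show ?case using continuous_on_cong[of U U f g] by auto
next
  case (Suc k)
  have g': "(g has_derivative frechet_derivative f (at x)) (at x)" if "x \<in> U" for x
  proof -
    have "(f has_derivative frechet_derivative f (at x)) (at x)"
      using Suc.prems(2) that by (auto simp: frechet_derivative_works)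
    then show ?thesis
      by (rule has_derivative_transform_within_open[OF _ \<open>open U\<close> that Suc.prems(1)])
  qed
  have "Ck_on k U (\<lambda>x. frechet_derivative g (at x) v)" for v
  proof (rule Suc.IH)
    show "Ck_on k U (\<lambda>x. frechet_derivative f (at x) v)" using Suc.prems(2) by simp
    show "frechet_derivative f (at x) v = frechet_derivative g (at x) v" if "x \<in> U" for x
      using frechet_derivative_at[OF g'[OF that]] by simp
  qed
  with g' show ?case by (auto simp: differentiable_def)
qed

lemma Ck_on_SucI:
  assumes "open U" "\<And>x. x \<in> U \<Longrightarrow> (f has_derivative f' x) (at x)"
    "\<And>v. Ck_on k U (\<lambda>x. f' x v)"
  shows "Ck_on (Suc k) U f"
proof -
  have "Ck_on k U (\<lambda>x. frechet_derivative f (at x) v)" for v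
    by (rule Ck_on_cong[OF assms(1) _ assms(3)[of v]])
      (use frechet_derivative_at[OF assms(2)] in simp)
  then show ?thesis using assms(2) by (auto simp: differentiable_def)
qed

lemma Ck_on_SucD:
  assumes "Ck_on (Suc k) U f" "x \<in> U"
  shows "(f has_derivative frechet_derivative f (at x)) (at x)"
  using assms by (auto simp: frechet_derivative_works)

lemma Ck_on_Suc_imp: "Ck_on (Suc k) U f \<Longrightarrow> Ck_on k U f"
proof (induction k arbitrary: f)
  case 0
  then show ?case
    by (auto intro: differentiable_imp_continuous_on
        simp: differentiable_on_def differentiable_at_withinI)
next
  case (Suc k)
  have "Ck_on k U (\<lambda>x. frechet_derivative f (at x) v)" for v
    by (rule Suc.IH) (use Suc.prems in auto)
  then show ?case using Suc.prems by simp
qed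

lemma Ck_on_subset: "Ck_on k U f \<Longrightarrow> V \<subseteq> U \<Longrightarrow> Ck_on k V f"
  by (induction k arbitrary: f) (auto intro: continuous_on_subset)

text \<open>Each order of differentiability is a condition at points, so \<open>C\<^sup>k\<close> maps may be recognised on
  an open cover; this glues the local implicit functions of a hypersurface together.\<close>
lemma Ck_on_local:
  assumes "\<And>x. x \<in> U \<Longrightarrow> \<exists>V. open V \<and> x \<in> V \<and> Ck_on k V f"
  shows "Ck_on k U f"
  using assms
proof (induction k arbitrary: f)
  case 0
  then show ?case
    unfolding Ck_on.simps
    by (meson continuous_at_imp_continuous_on continuous_on_eq_continuous_at)
next
  case (Suc k)
  have "Ck_on k U (\<lambda>x. frechet_derivative f (at x) v)" for v
  proof (rule Suc.IH)
    fix x assume "x \<in> U"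
    then obtain V where "open V" "x \<in> V" "Ck_on (Suc k) V f" using Suc.prems by blast
    then show "\<exists>V. open V \<and> x \<in> V \<and> Ck_on k V (\<lambda>x. frechet_derivative f (at x) v)" by auto
  qed
  moreover have "f differentiable at x" if x: "x \<in> U" for x
    using Suc.prems[OF x] by auto
  ultimately show ?case by simp
qed

lemma Ck_on_const: "Ck_on k U (\<lambda>x. c)"
  by (induction k arbitrary: c) (auto simp del: One_nat_def)

lemma Ck_on_bounded_linear:
  assumes "bounded_linear h" "open U"
  shows "Ck_on k U h"
proof (cases k)
  case 0
  then show ?thesis using assms by (simp add: linear_continuous_on)
next
  case (Suc m)
  show ?thesis unfolding Suc
    by (rule Ck_on_SucI[OF assms(2) bounded_linear_imp_has_derivative[OF assms(1)] Ck_on_const])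
qed

lemma Ck_on_add:
  assumes "open U" "Ck_on k U f" "Ck_on k U g"
  shows "Ck_on k U (\<lambda>x. f x + g x)"
  using assms(2,3)
proof (induction k arbitrary: f g)
  case 0
  then show ?case by (auto intro: continuous_on_add)
next
  case (Suc k)
  show ?case
    by (rule Ck_on_SucI[OF assms(1)
        has_derivative_add[OF Ck_on_SucD[OF Suc.prems(1)] Ck_on_SucD[OF Suc.prems(2)]]])
      (use Suc in auto)
qed

lemma Ck_on_bilinear:
  assumes "bounded_bilinear B" "open U" "Ck_on k U f" "Ck_on k U g"
  shows "Ck_on k U (\<lambda>x. B (f x) (g x))"
  using assms(3,4)
proof (induction k arbitrary: f g)
  case 0
  then show ?case using bounded_bilinear.continuous_on[OF assms(1)] by auto
next
  case (Suc k)
  show ?case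
  proof (rule Ck_on_SucI[OF assms(2)])
    show "((\<lambda>x. B (f x) (g x)) has_derivative
        (\<lambda>v. B (f x) (frechet_derivative g (at x) v) + B (frechet_derivative f (at x) v) (g x)))
      (at x)" if "x \<in> U" for x
      using bounded_bilinear.FDERIV[OF assms(1) Ck_on_SucD[OF Suc.prems(1) that]
        Ck_on_SucD[OF Suc.prems(2) that]] .
    fix v
    have "Ck_on k U (\<lambda>x. B (f x) (frechet_derivative g (at x) v))"
      by (rule Suc.IH) (use Suc.prems Ck_on_Suc_imp in auto)
    moreover have "Ck_on k U (\<lambda>x. B (frechet_derivative f (at x) v) (g x))"
      by (rule Suc.IH) (use Suc.prems Ck_on_Suc_imp in auto)
    ultimately show "Ck_on k U (\<lambda>x. B (f x) (frechet_derivative g (at x) v) +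
        B (frechet_derivative f (at x) v) (g x))"
      by (rule Ck_on_add[OF assms(2)])
  qed
qed

lemma Ck_on_sum:
  assumes "open U" "\<And>i. i \<in> I \<Longrightarrow> Ck_on k U (f i)"
  shows "Ck_on k U (\<lambda>x. \<Sum>i\<in>I. f i x)"
  using assms(2)
  by (induction I rule: infinite_finite_induct)
    (auto intro: Ck_on_const Ck_on_add[OF assms(1)])

lemma Ck_on_linear_image:
  assumes "bounded_linear h" "open U" "Ck_on k U f"
  shows "Ck_on k U (\<lambda>x. h (f x))"
  using assms(3)
proof (induction k arbitrary: f)
  case 0
  then show ?case using bounded_linear.continuous_on[OF assms(1)] by auto
next
  case (Suc k)
  show ?case
    by (rule Ck_on_SucI[OF assms(2)
        bounded_linear.has_derivative[OF assms(1) Ck_on_SucD[OF Suc.prems(1)]]])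
      (use Suc in auto)
qed

lemma Ck_on_Pair:
  assumes "open U" "Ck_on k U f" "Ck_on k U g"
  shows "Ck_on k U (\<lambda>x. (f x, g x))"
  using assms(2,3)
proof (induction k arbitrary: f g)
  case 0
  then show ?case by (auto intro: continuous_on_Pair)
next
  case (Suc k)
  show ?case
    by (rule Ck_on_SucI[OF assms(1)
        has_derivative_Pair[OF Ck_on_SucD[OF Suc.prems(1)] Ck_on_SucD[OF Suc.prems(2)]]])
      (use Suc in auto)
qed

lemma Ck_on_inverse:
  fixes f :: "'a::euclidean_space \<Rightarrow> real"
  assumes "open U" "Ck_on k U f" "\<And>x. x \<in> U \<Longrightarrow> f x \<noteq> 0"
  shows "Ck_on k U (\<lambda>x. inverse (f x))"
  using assms(2)
proof (induction k)
  case 0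
  then show ?case using assms(3) by (auto intro: continuous_on_inverse)
next
  case (Suc k)
  note mult = Ck_on_bilinear[OF bounded_bilinear_mult assms(1)]
  note inv = Suc.IH[OF Ck_on_Suc_imp[OF Suc.prems]]
  show ?case
  proof (rule Ck_on_SucI[OF assms(1)])
    show "((\<lambda>x. inverse (f x)) has_derivative
        (\<lambda>v. - (inverse (f x) * frechet_derivative f (at x) v * inverse (f x)))) (at x)"
      if "x \<in> U" for x
      by (rule Deriv.has_derivative_inverse[OF assms(3)[OF that] Ck_on_SucD[OF Suc.prems that]])
    fix v
    have "Ck_on k U (\<lambda>x. frechet_derivative f (at x) v)" using Suc.prems by simp
    then show "Ck_on k U (\<lambda>x. - (inverse (f x) * frechet_derivative f (at x) v * inverse (f x)))"
      by (intro Ck_on_linear_image[OF bounded_linear_minus[OF bounded_linear_ident] assms(1)] mult inv)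
  qed
qed

text \<open>Expanding \<open>Dg(x)v\<close> in the standard basis turns \<open>Df(g(x))(Dg(x)v)\<close> into a finite sum of
  products of a \<open>C\<^sup>k\<close> coefficient with \<open>D\<^sub>bf \<circ> g\<close>, where \<open>D\<^sub>bf\<close> has one derivative less than \<open>f\<close>.
  Induction on the order therefore stays within compositions with the same \<open>g\<close>.\<close>
lemma Ck_on_compose:
  fixes f :: "'b::euclidean_space \<Rightarrow> 'c::real_normed_vector"
  assumes "open U" "open V" "Ck_on k V f" "Ck_on k U g" "g ` U \<subseteq> V"
  shows "Ck_on k U (\<lambda>x. f (g x))"
  using assms(3-5)
proof (induction k arbitrary: f)
  case 0
  then show ?case using continuous_on_compose2[of V f U g] by auto
next
  case (Suc k)
  let ?Df = "\<lambda>y. frechet_derivative f (at y)" and ?Dg = "\<lambda>x. frechet_derivative g (at x)"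
  show ?case
  proof (rule Ck_on_SucI[OF assms(1)])
    fix x assume x: "x \<in> U"
    have f': "(f has_derivative ?Df (g x)) (at (g x))"
      using Ck_on_SucD[OF Suc.prems(1)] Suc.prems(3) x by blast
    then have lin: "linear (?Df (g x))" by (rule has_derivative_linear)
    have expand: "?Df (g x) w = (\<Sum>b\<in>Basis. (w \<bullet> b) *\<^sub>R ?Df (g x) b)" for w
    proof -
      have "?Df (g x) w = ?Df (g x) (\<Sum>b\<in>Basis. (w \<bullet> b) *\<^sub>R b)" by (simp add: euclidean_representation)
      also have "\<dots> = (\<Sum>b\<in>Basis. (w \<bullet> b) *\<^sub>R ?Df (g x) b)"
        using lin by (simp add: linear_sum linear_scale)
      finally show ?thesis .
    qed
    have "((\<lambda>x. f (g x)) has_derivative (\<lambda>v. ?Df (g x) (?Dg x v))) (at x)"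
      using diff_chain_at[OF Ck_on_SucD[OF Suc.prems(2) x] f'] by (simp add: o_def)
    then show "((\<lambda>x. f (g x)) has_derivative
        (\<lambda>v. \<Sum>b\<in>Basis. (?Dg x v \<bullet> b) *\<^sub>R ?Df (g x) b)) (at x)"
      by (subst (asm) expand)
  next
    fix v
    have "Ck_on k U (\<lambda>x. ?Df (g x) b)" for b
      by (rule Suc.IH) (use Suc.prems(1,3) Ck_on_Suc_imp[OF Suc.prems(2)] in simp_all)
    moreover have "Ck_on k U (\<lambda>x. ?Dg x v \<bullet> b)" for b
      using Suc.prems(2) by (intro Ck_on_linear_image[OF bounded_linear_inner_left assms(1)]) simp
    ultimately show "Ck_on k U (\<lambda>x. \<Sum>b\<in>Basis. (?Dg x v \<bullet> b) *\<^sub>R ?Df (g x) b)"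
      by (intro Ck_on_sum Ck_on_bilinear[OF bounded_bilinear_scaleR] assms(1))
  qed
qed

section \<open>A scalar implicit function theorem\<close>

lemma smooth_on_imp_Ck: "smooth_on U f \<Longrightarrow> Ck_on k U f"
  by (simp add: smooth_on_def)

lemma smooth_on_has_derivative:
  assumes "smooth_on U f" "x \<in> U"
  shows "(f has_derivative frechet_derivative f (at x)) (at x)"
  using Ck_on_SucD[OF smooth_on_imp_Ck[OF assms(1)] assms(2)] .

lemma smooth_on_frechet_derivative:
  assumes "smooth_on U f"
  shows "smooth_on U (\<lambda>x. frechet_derivative f (at x) v)"
  using smooth_on_imp_Ck[OF assms, of "Suc _"] by (simp add: smooth_on_def)

text \<open>The inverse function theorem, applied to \<open>(x, t) \<mapsto> (x, \<psi>(x, t))\<close>, gives a differentiable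
  solution \<open>g\<close>.  Differentiating \<open>\<psi>(x, g(x)) = 0\<close> expresses \<open>Dg\<close> as a quotient of derivatives of \<open>\<psi>\<close>
  along the graph of \<open>g\<close>, so that \<open>g\<close> gains one order of smoothness at a time.\<close>
lemma scalar_implicit_function:
  fixes \<psi> :: "'a::euclidean_space \<times> real \<Rightarrow> real"
  assumes "open U" and smooth: "smooth_on U \<psi>" and p0: "(x0, t0) \<in> U" "\<psi> (x0, t0) = 0"
    and nz: "frechet_derivative \<psi> (at (x0, t0)) (0, 1) \<noteq> 0"
  obtains A g where "open A" "x0 \<in> A" "smooth_on A g" "g x0 = t0"
    "\<And>x. x \<in> A \<Longrightarrow> (x, g x) \<in> U" "\<And>x. x \<in> A \<Longrightarrow> \<psi> (x, g x) = 0"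
proof -
  define D where "D p = frechet_derivative \<psi> (at p)" for p
  have D: "(\<psi> has_derivative D p) (at p)" if "p \<in> U" for p
    unfolding D_def by (rule smooth_on_has_derivative[OF smooth that])
  have Dcont: "continuous_on U (\<lambda>p. D p v)" for v
    using smooth_on_imp_Ck[OF smooth_on_frechet_derivative[OF smooth], of 0] by (simp add: D_def)
  define W where "W = {p \<in> U. D p (0, 1) \<noteq> 0}"
  have "open ((\<lambda>p. D p (0, 1)) -` (- {0}) \<inter> U)"
    using continuous_on_open_vimage[OF \<open>open U\<close>, of "\<lambda>p. D p (0, 1)"] Dcont[of "(0,1)"] by blast
  then have W: "open W" by (simp add: W_def vimage_def Int_def conj_commute)
  have "W \<subseteq> U" by (auto simp: W_def)
  have p0W: "(x0, t0) \<in> W" using p0 nz by (simp add: W_def D_def)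
  define F where "F p = (fst p, \<psi> p)" for p
  define F' where "F' p = Blinfun (\<lambda>v. (fst v, D p v))" for p
  have F'_apply: "blinfun_apply (F' p) = (\<lambda>v. (fst v, D p v))" if "p \<in> U" for p
    unfolding F'_def
    by (intro bounded_linear_Blinfun_apply bounded_linear_Pair bounded_linear_fst
        has_derivative_bounded_linear[OF D[OF that]])
  define d where "d = D (x0, t0) (0, 1)"
  have d: "d \<noteq> 0" using nz by (simp add: d_def D_def)
  have bl: "bounded_linear (D (x0, t0))" using has_derivative_bounded_linear[OF D[OF p0(1)]] .
  define J where "J = Blinfun (\<lambda>v :: 'a \<times> real. (fst v, (snd v - D (x0, t0) (fst v, 0)) / d))"
  have J_apply: "blinfun_apply J = (\<lambda>v. (fst v, (snd v - D (x0, t0) (fst v, 0)) / d))"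
  proof -
    have "bounded_linear (\<lambda>v :: 'a \<times> real. D (x0, t0) (fst v, 0))"
      by (rule bounded_linear_compose[OF bl])
        (intro bounded_linear_Pair bounded_linear_fst bounded_linear_zero)
    then show ?thesis
      unfolding J_def
      by (intro bounded_linear_Blinfun_apply bounded_linear_Pair bounded_linear_fst
          bounded_linear_divide[THEN bounded_linear_compose] bounded_linear_sub bounded_linear_snd)
  qed
  have J: "J o\<^sub>L F' (x0, t0) = id_blinfun"
  proof (rule blinfun_eqI)
    fix v :: "'a \<times> real"
    have "D (x0, t0) v - D (x0, t0) (fst v, 0) = D (x0, t0) (snd v *\<^sub>R (0, 1))"
      by (simp add: linear_diff[OF bounded_linear.linear[OF bl], symmetric] minus_prod_def)
    also have "\<dots> = snd v * d"
      by (simp add: linear_scale[OF bounded_linear.linear[OF bl]] d_def del: scaleR_Pair)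
    finally show "blinfun_apply (J o\<^sub>L F' (x0, t0)) v = blinfun_apply id_blinfun v"
      using d by (simp add: J_apply F'_apply[OF p0(1)])
  qed
  have Fder: "(F has_derivative blinfun_apply (F' p)) (at p)" if "p \<in> W" for p
    using that \<open>W \<subseteq> U\<close> unfolding F_def
    by (subst F'_apply) (auto intro!: derivative_eq_intros D)
  have "continuous_on W F'"
  proof (rule continuous_on_blinfun_componentwise)
    fix i :: "'a \<times> real"
    have "continuous_on W (\<lambda>p. (fst i, D p i))"
      using Dcont[of i] \<open>W \<subseteq> U\<close> by (intro continuous_on_Pair continuous_on_const)
        (auto intro: continuous_on_subset)
    then show "continuous_on W (\<lambda>p. blinfun_apply (F' p) i)"
      using \<open>W \<subseteq> U\<close> by (subst continuous_on_cong[OF refl]) (auto simp: F'_apply subset_eq)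
  qed
  from inverse_function_theorem[OF W Fder this p0W J]
  obtain U' V G G' where U': "open U'" "U' \<subseteq> W" "(x0, t0) \<in> U'"
    and V: "open V" "F (x0, t0) \<in> V" and hom: "homeomorphism U' V F G"
    and G: "\<And>y. y \<in> V \<Longrightarrow> (G has_derivative G' y) (at y)"
    by metis
  define A where "A = {x. (x, 0::real) \<in> V}"
  define g where "g x = snd (G (x, 0))" for x
  have "open A"
    using open_vimage[OF V(1), of "\<lambda>x. (x, 0)"] by (simp add: A_def vimage_def continuous_intros)
  have FG: "F (G (x, 0)) = (x, 0)" "G (x, 0) \<in> U'" if "x \<in> A" for x
    using hom that unfolding homeomorphism_def A_def by auto
  have graph: "(x, g x) = G (x, 0)" if "x \<in> A" for x
    using FG(1)[OF that] by (simp add: F_def g_def prod_eq_iff)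
  have inW: "(x, g x) \<in> W" if "x \<in> A" for x
    using graph FG(2) that U'(2) by auto
  have zero: "\<psi> (x, g x) = 0" if "x \<in> A" for x
    using FG(1)[OF that] graph[OF that] by (simp add: F_def)
  define q where "q x v = - D (x, g x) (v, 0) * inverse (D (x, g x) (0, 1))" for x v
  have gder: "(g has_derivative q x) (at x)" if x: "x \<in> A" for x
  proof -
    have "((\<lambda>x. G (x, 0)) has_derivative (\<lambda>v. G' (x, 0) (v, 0))) (at x)"
      using x by (intro has_derivative_compose[of "\<lambda>x. (x, 0)" _ x UNIV G])
        (auto intro!: derivative_eq_intros G simp: A_def)
    then obtain g' where g': "(g has_derivative g') (at x)"
      unfolding g_def using has_derivative_snd by blast
    have xU: "(x, g x) \<in> U" using inW[OF x] \<open>W \<subseteq> U\<close> by blast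
    have "((\<lambda>x. \<psi> (x, g x)) has_derivative (\<lambda>v. D (x, g x) (v, g' v))) (at x)"
      by (rule has_derivative_compose[of "\<lambda>x. (x, g x)" _ x UNIV \<psi>])
        (auto intro!: derivative_eq_intros g' D xU)
    moreover have "((\<lambda>x. \<psi> (x, g x)) has_derivative (\<lambda>v. 0)) (at x)"
      by (rule has_derivative_transform_within_open[OF has_derivative_const \<open>open A\<close> x])
        (simp add: zero)
    ultimately have eq: "D (x, g x) (v, g' v) = 0" for v
      using has_derivative_unique by metis
    have lin: "linear (D (x, g x))" using D[OF xU] by (rule has_derivative_linear)
    have "g' v = q x v" for v
    proof -
      have "(v, g' v) = (v, 0) + g' v *\<^sub>R (0, 1)" by simp
      then have "D (x, g x) (v, 0) + g' v * D (x, g x) (0, 1) = 0"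
        using eq[of v] linear_add[OF lin] linear_scale[OF lin] by (metis real_scaleR_def)
      moreover have "D (x, g x) (0, 1) \<noteq> 0" using inW[OF x] by (simp add: W_def)
      ultimately show ?thesis by (simp add: q_def field_simps)
    qed
    then have "g' = q x" by (rule ext)
    then show ?thesis using g' by (simp only:)
  qed
  have "Ck_on k A g" for k
  proof (induction k)
    case 0
    then show ?case
      unfolding Ck_on.simps
      by (intro continuous_at_imp_continuous_on ballI has_derivative_continuous[OF gder])
  next
    case (Suc k)
    have comp: "Ck_on k A (\<lambda>x. D (x, g x) v)" for v
      unfolding D_def
      by (rule Ck_on_compose[OF \<open>open A\<close> \<open>open U\<close> smooth_on_imp_Ck[OF smooth_on_frechet_derivative[OF smooth]]
            Ck_on_Pair[OF \<open>open A\<close> Ck_on_bounded_linear[OF bounded_linear_ident \<open>open A\<close>] Suc.IH]])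
        (use inW \<open>W \<subseteq> U\<close> in auto)
    show ?case
    proof (rule Ck_on_SucI[OF \<open>open A\<close> gder])
      show "Ck_on k A (\<lambda>x. q x v)" for v
        unfolding q_def using inW
        by (intro Ck_on_bilinear[OF bounded_bilinear_mult \<open>open A\<close>] comp
            Ck_on_linear_image[OF bounded_linear_minus[OF bounded_linear_ident] \<open>open A\<close>]
            Ck_on_inverse[OF \<open>open A\<close>]) (auto simp: W_def)
    qed
  qed
  then have "smooth_on A g" by (simp add: smooth_on_def)
  moreover have "x0 \<in> A" "g x0 = t0"
  proof -
    have "F (x0, t0) = (x0, 0)" using p0 by (simp add: F_def)
    moreover from this show "x0 \<in> A" using V(2) by (simp add: A_def)
    ultimately show "g x0 = t0"
      using hom U'(3) by (metis g_def homeomorphism_def snd_conv)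
  qed
  ultimately show thesis
    using that[of A g] \<open>open A\<close> inW zero \<open>W \<subseteq> U\<close> by blast
qed

section \<open>Tangent spaces of spacelike graphs\<close>

lemma smooth_on_affine_line:
  "open U \<Longrightarrow> smooth_on U (\<lambda>t :: real. p + t *\<^sub>R v)"
  unfolding smooth_on_def
  by (intro allI Ck_on_add Ck_on_const Ck_on_bounded_linear bounded_linear_scaleR_left)

lemma smooth_on_add:
  assumes "open U" "smooth_on U f" "smooth_on U g"
  shows "smooth_on U (\<lambda>x. f x + g x)"
  using assms Ck_on_add unfolding smooth_on_def by blast

lemma smooth_on_scaleR_const:
  assumes "open U" "smooth_on U f"
  shows "smooth_on U (\<lambda>x. f x *\<^sub>R e)"
  using assms Ck_on_linear_image[OF bounded_linear_scaleR_left] unfolding smooth_on_def by blast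

lemma smooth_on_compose:
  fixes f :: "'b::euclidean_space \<Rightarrow> 'c::real_normed_vector"
  assumes "open U" "open V" "smooth_on V f" "smooth_on U g" "g ` U \<subseteq> V"
  shows "smooth_on U (\<lambda>x. f (g x))"
  using Ck_on_compose[OF assms(1,2) _ _ assms(5)] assms(3,4) unfolding smooth_on_def by blast

lemma smooth_on_Pair:
  assumes "open U" "smooth_on U f" "smooth_on U g"
  shows "smooth_on U (\<lambda>x. (f x, g x))"
  using assms Ck_on_Pair unfolding smooth_on_def by blast

lemma smooth_on_subset: "smooth_on U f \<Longrightarrow> V \<subseteq> U \<Longrightarrow> smooth_on V f"
  using Ck_on_subset unfolding smooth_on_def by blast

text \<open>Restrict \<open>\<phi>\<close> to the plane through \<open>p\<close> spanned by \<open>v\<close> and a direction \<open>e\<close> that is transversal to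
  the level set.  There the zero set is the graph of an implicit function of one variable with
  derivative \<open>0\<close>, which is a smooth curve in \<open>S\<close> with velocity \<open>v\<close>.\<close>
lemma kernel_subset_tangent_space:
  fixes \<phi> :: "'a::euclidean_space \<Rightarrow> real"
  assumes U: "open U" "p \<in> U" and smooth: "smooth_on U \<phi>"
    and level: "S \<inter> U = {q \<in> U. \<phi> q = 0}" and "p \<in> S"
    and regular: "frechet_derivative \<phi> (at p) \<noteq> (\<lambda>v. 0)"
    and v: "frechet_derivative \<phi> (at p) v = 0"
  shows "v \<in> tangent_space S p"
proof -
  let ?D = "frechet_derivative \<phi> (at p)"
  obtain e where e: "?D e \<noteq> 0" using regular by blast
  have D: "(\<phi> has_derivative ?D) (at p)" by (rule smooth_on_has_derivative[OF smooth U(2)])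
  have lin: "linear ?D" using D by (rule has_derivative_linear)
  define k where "k = (\<lambda>s :: real \<times> real. p + (fst s *\<^sub>R v + snd s *\<^sub>R e))"
  have k: "smooth_on T k" if "open T" for T
    unfolding smooth_on_def k_def using that
    by (intro allI Ck_on_add Ck_on_const Ck_on_bounded_linear bounded_linear_add
        bounded_linear_scaleR_left[THEN bounded_linear_compose] bounded_linear_fst bounded_linear_snd)
  define U' where "U' = k -` U"
  have "open U'"
    unfolding U'_def k_def by (intro open_vimage U(1) continuous_intros)
  have \<psi>: "smooth_on U' (\<lambda>s. \<phi> (k s))"
    by (rule smooth_on_compose[OF \<open>open U'\<close> U(1) smooth k]) (auto simp: U'_def \<open>open U'\<close>[unfolded U'_def])
  have k0: "k (0, 0) = p" by (simp add: k_def)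
  have kder: "(k has_derivative (\<lambda>s. fst s *\<^sub>R v + snd s *\<^sub>R e)) (at s)" for s
    unfolding k_def by (auto intro!: derivative_eq_intros)
  have "((\<lambda>s. \<phi> (k s)) has_derivative (\<lambda>s. ?D (fst s *\<^sub>R v + snd s *\<^sub>R e))) (at (0, 0))"
    by (rule has_derivative_compose[OF kder]) (simp add: k0 D)
  from fun_cong[OF frechet_derivative_at[OF this], of "(0, 1)"]
  have "frechet_derivative (\<lambda>s. \<phi> (k s)) (at (0, 0)) (0, 1) \<noteq> 0"
    using e by (simp only: fst_conv snd_conv scaleR_zero_left scaleR_one add_0_left) simp
  moreover have "(0, 0) \<in> U'" "\<phi> (k (0, 0)) = 0"
    using U(2) level \<open>p \<in> S\<close> by (auto simp: U'_def k0)
  ultimately obtain A g where A: "open A" "0 \<in> A" and g: "smooth_on A g" "g 0 = 0"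
    and on: "\<And>t. t \<in> A \<Longrightarrow> (t, g t) \<in> U'" "\<And>t. t \<in> A \<Longrightarrow> \<phi> (k (t, g t)) = 0"
    using scalar_implicit_function[OF \<open>open U'\<close> \<psi>] by metis
  define c where "c t = (p + t *\<^sub>R v) + g t *\<^sub>R e" for t
  have kc: "k (t, g t) = c t" for t by (simp add: k_def c_def algebra_simps)
  obtain \<delta> where \<delta>: "\<delta> > 0" "{-\<delta><..<\<delta>} \<subseteq> A"
  proof -
    obtain \<delta> where "\<delta> > 0" "ball 0 \<delta> \<subseteq> A" using A openE by blast
    then show thesis by (intro that[of \<delta>]) (auto simp: ball_eq_greaterThanLessThan)
  qed
  have "smooth_on {-\<delta><..<\<delta>} c"
    unfolding c_def
    by (intro smooth_on_add smooth_on_affine_line smooth_on_scaleR_const smooth_on_subset[OF g(1) \<delta>(2)])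
       auto
  moreover have "c ` {-\<delta><..<\<delta>} \<subseteq> S"
    using on \<delta>(2) level by (fastforce simp: kc U'_def)
  moreover have c0: "c 0 = p" by (simp add: c_def g)
  moreover have "(c has_vector_derivative v) (at 0)"
  proof -
    obtain g' where g': "(g has_derivative g') (at 0)"
      using smooth_on_has_derivative[OF g(1) A(2)] by blast
    have "g' = (\<lambda>t. t *\<^sub>R g' 1)"
    proof
      show "g' t = t *\<^sub>R g' 1" for t
        using linear_scale[OF has_derivative_linear[OF g'], of t 1] by simp
    qed
    then have gv: "(g has_vector_derivative g' 1) (at 0)"
      unfolding has_vector_derivative_def by (rule has_derivative_eq_rhs[OF g'])
    have c': "(c has_vector_derivative v + g' 1 *\<^sub>R e) (at 0)"
      unfolding c_def by (auto intro!: derivative_eq_intros gv[folded has_real_derivative_iff_has_vector_derivative])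
    then have "((\<lambda>t. \<phi> (c t)) has_derivative (\<lambda>t. ?D (t *\<^sub>R (v + g' 1 *\<^sub>R e)))) (at 0)"
      unfolding has_vector_derivative_def
      by (rule has_derivative_compose) (simp add: c0 D)
    moreover have "((\<lambda>t. \<phi> (c t)) has_derivative (\<lambda>t. 0)) (at 0)"
      by (rule has_derivative_transform_within_open[OF has_derivative_const A]) (simp add: on(2)[unfolded kc])
    ultimately have "(\<lambda>t. ?D (t *\<^sub>R (v + g' 1 *\<^sub>R e))) = (\<lambda>t. 0)"
      by (rule has_derivative_unique)
    from fun_cong[OF this, of 1] have "?D (v + g' 1 *\<^sub>R e) = 0" by simp
    then have "g' 1 = 0" using e v linear_add[OF lin] linear_scale[OF lin] by simp
    with c' show ?thesis by simp
  qed
  ultimately show ?thesis unfolding tangent_space_def using \<delta>(1) by blast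
qed

text \<open>An entire hypersurface is the graph of a function about which nothing is known beforehand.
  A defining function \<open>\<phi>\<close> of the hypersurface has a nonzero derivative in the vertical direction,
  since a vertical tangent vector would be timelike.  The implicit function of \<open>\<phi>\<close> then agrees with
  \<open>f\<close>, because its graph lies in that of \<open>f\<close>.\<close>
lemma spacelike_graph_smooth:
  fixes S :: "'n::finite minkowski set"
  assumes S: "spacelike_hypersurface S" and graph: "S = {(x, t). t = f x}"
  shows "smooth_on UNIV f"
proof -
  have "\<exists>A. open A \<and> x \<in> A \<and> Ck_on k A f" for x k
  proof -
    have p: "(x, f x) \<in> S" by (simp add: graph)
    then obtain U and \<phi> :: "'n minkowski \<Rightarrow> real" where U: "open U" "(x, f x) \<in> U"
      and \<phi>: "smooth_on U \<phi>" "S \<inter> U = {q \<in> U. \<phi> q = 0}"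
      and nz: "frechet_derivative \<phi> (at (x, f x)) \<noteq> (\<lambda>v. 0)"
      using S unfolding spacelike_hypersurface_def smooth_hypersurface_def by fast
    have "\<not> spacelike ((0, 1) :: 'n minkowski)" by (simp add: spacelike_def mink_def)
    then have "(0, 1) \<notin> tangent_space S (x, f x)"
      using S p unfolding spacelike_hypersurface_def by (metis prod.inject zero_neq_one zero_prod_def)
    then have "frechet_derivative \<phi> (at (x, f x)) (0, 1) \<noteq> 0"
      using kernel_subset_tangent_space[OF U \<phi> p nz] by blast
    moreover have "\<phi> (x, f x) = 0" using p U(2) \<phi>(2) by blast
    ultimately obtain A g where A: "open A" "x \<in> A" "smooth_on A g"
      "\<And>y. y \<in> A \<Longrightarrow> (y, g y) \<in> U" "\<And>y. y \<in> A \<Longrightarrow> \<phi> (y, g y) = 0"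
      using scalar_implicit_function[OF U(1) \<phi>(1) U(2)] by metis
    have "g y = f y" if "y \<in> A" for y
      using A(4,5)[OF that] \<phi>(2) graph by blast
    then have "Ck_on k A f" using Ck_on_cong[OF A(1) _ smooth_on_imp_Ck[OF A(3)]] by blast
    then show ?thesis using A by blast
  qed
  then show ?thesis unfolding smooth_on_def by (auto intro: Ck_on_local)
qed

lemma tangent_space_smooth_graph:
  fixes f :: "'a::euclidean_space \<Rightarrow> real"
  assumes f: "smooth_on UNIV f"
  shows "tangent_space {(x, t). t = f x} (x, f x) = range (\<lambda>v. (v, frechet_derivative f (at x) v))"
    (is "?T = range ?h")
proof (rule set_eqI, rule iffI)
  have D: "(f has_derivative frechet_derivative f (at x)) (at x)" for x
    by (rule smooth_on_has_derivative[OF f UNIV_I])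
  {
    fix X assume "X \<in> ?T"
    then obtain \<delta> c where c: "\<delta> > 0" "c ` {-\<delta><..<\<delta>} \<subseteq> {(x, t). t = f x}" "c 0 = (x, f x)"
      "(c has_vector_derivative X) (at 0)"
      unfolding tangent_space_def mem_Collect_eq by (elim exE conjE) (rule that; assumption)
    have c1: "((\<lambda>t. fst (c t)) has_derivative (\<lambda>t. t *\<^sub>R fst X)) (at 0)"
      and c2: "((\<lambda>t. snd (c t)) has_derivative (\<lambda>t. t *\<^sub>R snd X)) (at 0)"
      using has_derivative_fst[OF c(4)[unfolded has_vector_derivative_def]]
        has_derivative_snd[OF c(4)[unfolded has_vector_derivative_def]] by simp_all
    have "((\<lambda>t. f (fst (c t))) has_derivative (\<lambda>t. frechet_derivative f (at x) (t *\<^sub>R fst X))) (at 0)"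
      by (rule has_derivative_compose[OF c1]) (simp add: c D)
    moreover have "snd (c t) = f (fst (c t))" if "t \<in> {-\<delta><..<\<delta>}" for t
      using subsetD[OF c(2) imageI[OF that]] by (simp add: case_prod_beta)
    then have "((\<lambda>t. f (fst (c t))) has_derivative (\<lambda>t. t *\<^sub>R snd X)) (at 0)"
      by (intro has_derivative_transform_within_open[OF c2, of "{-\<delta><..<\<delta>}"]) (use c(1) in auto)
    ultimately have "(\<lambda>t. frechet_derivative f (at x) (t *\<^sub>R fst X)) = (\<lambda>t. t *\<^sub>R snd X)"
      by (rule has_derivative_unique)
    from fun_cong[OF this, of 1] have "X = ?h (fst X)" by (simp add: prod_eq_iff)
    then show "X \<in> range ?h" by blast
  next
    fix X assume "X \<in> range ?h"
    then obtain v where X: "X = ?h v" by blast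
    define c where "c t = (x + t *\<^sub>R v, f (x + t *\<^sub>R v))" for t :: real
    have "smooth_on {-1<..<1} c"
      unfolding c_def
      by (intro smooth_on_Pair smooth_on_affine_line smooth_on_compose[OF _ open_UNIV f]) auto
    moreover have "(c has_vector_derivative X) (at 0)"
    proof -
      have l: "((\<lambda>t. x + t *\<^sub>R v) has_derivative (\<lambda>t. t *\<^sub>R v)) (at 0)"
        by (auto intro!: derivative_eq_intros)
      have "((\<lambda>t. f (x + t *\<^sub>R v)) has_derivative (\<lambda>t. frechet_derivative f (at x) (t *\<^sub>R v))) (at 0)"
        by (rule has_derivative_compose[OF l]) (simp add: D)
      from has_derivative_Pair[OF l this] show ?thesis
        unfolding has_vector_derivative_def c_def X
        by (simp add: linear_scale[OF has_derivative_linear[OF D]])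
    qed
    ultimately show "X \<in> ?T"
      unfolding tangent_space_def
      by (intro CollectI exI[of _ 1] exI[of _ c] conjI) (auto simp: c_def)
  }
qed

section \<open>Normal and mean curvature of a spacelike graph\<close>

lemma mink_commute: "mink v w = mink w v"
  by (simp add: mink_def inner_commute mult.commute)

lemma bounded_bilinear_mink: "bounded_bilinear (mink :: 'n::finite minkowski \<Rightarrow> _)"
proof -
  have "bounded_linear (\<lambda>w :: 'n minkowski. (fst w, - snd w))"
    by (intro bounded_linear_Pair bounded_linear_fst bounded_linear_minus bounded_linear_snd)
  from bounded_bilinear.comp[OF bounded_bilinear_inner bounded_linear_ident this]
  show ?thesis by (simp add: mink_def[abs_def] inner_prod_def)
qed

interpretation mink: bounded_bilinear "mink :: 'n::finite minkowski \<Rightarrow> _"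
  by (rule bounded_bilinear_mink)

text \<open>If \<open>v = \<Sum>\<^sub>i l\<^sub>i(v) U\<^sub>i\<close> on \<open>V\<close>, then expanding the vectors of the basis chosen by \<^const>\<open>trace_on\<close> in
  the \<open>U\<^sub>i\<close> and exchanging the two sums moves the trace from that basis to the family \<open>U\<close>.  For an
  orthonormal family satisfying Parseval's identity, \<open>l\<^sub>i\<close> is the product with \<open>U\<^sub>i\<close>.\<close>
lemma trace_on_eq_sum:
  fixes V :: "'a::euclidean_space set"
  assumes V: "subspace V" and L: "linear L" "L ` V \<subseteq> V"
    and U: "finite I" "\<And>i. i \<in> I \<Longrightarrow> U i \<in> V" and l: "\<And>i. i \<in> I \<Longrightarrow> linear (l i)"
    and expand: "\<And>v. v \<in> V \<Longrightarrow> v = (\<Sum>i\<in>I. l i v *\<^sub>R U i)"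
  shows "trace_on V L = (\<Sum>i\<in>I. l i (L (U i)))"
proof -
  define B where "B = (SOME B. B \<subseteq> V \<and> independent B \<and> V \<subseteq> span B)"
  have "\<exists>B. B \<subseteq> V \<and> independent B \<and> V \<subseteq> span B"
    using maximal_independent_subset[of V] by metis
  then have B: "B \<subseteq> V" "independent B" "V \<subseteq> span B"
    unfolding B_def by (smt (verit) someI_ex)+
  have fin: "finite B" using B(2) by (rule independent_imp_finite)
  let ?r = "representation B"
  have rep: "(\<Sum>b\<in>B. ?r x b *\<^sub>R b) = x" if "x \<in> V" for x
    using sum_representation_eq[OF B(2) _ fin subset_refl] B(3) that by blast
  have LU: "L (U i) \<in> span B" "L (U i) \<in> V" if "i \<in> I" for i
    using L(2) B(3) U(2)[OF that] by blast+
  have row: "?r (L b) b = (\<Sum>i\<in>I. l i b * ?r (L (U i)) b)" if "b \<in> B" for b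
  proof -
    have "L b = L (\<Sum>i\<in>I. l i b *\<^sub>R U i)" using expand[of b] B(1) that by auto
    also have "\<dots> = (\<Sum>i\<in>I. l i b *\<^sub>R L (U i))" by (simp add: linear_sum[OF L(1)] linear_scale[OF L(1)])
    finally show ?thesis
      using LU(1) by (simp add: representation_sum[OF B(2)] representation_scale[OF B(2)] span_scale)
  qed
  have "trace_on V L = (\<Sum>b\<in>B. ?r (L b) b)" by (simp add: trace_on_def B_def Let_def)
  also have "\<dots> = (\<Sum>b\<in>B. \<Sum>i\<in>I. l i b * ?r (L (U i)) b)" by (rule sum.cong[OF refl row])
  also have "\<dots> = (\<Sum>i\<in>I. \<Sum>b\<in>B. l i b * ?r (L (U i)) b)" by (rule sum.swap)
  also have "\<dots> = (\<Sum>i\<in>I. l i (\<Sum>b\<in>B. ?r (L (U i)) b *\<^sub>R b))"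
    by (rule sum.cong[OF refl]) (simp add: linear_sum[OF l] linear_scale[OF l] mult.commute)
  also have "\<dots> = (\<Sum>i\<in>I. l i (L (U i)))" by (rule sum.cong[OF refl]) (simp add: rep LU(2))
  finally show ?thesis .
qed

text \<open>All that the geometric part of the argument needs to know about an entire spacelike
  hypersurface: it is the graph of a function with gradient \<open>a\<close> of length less than \<open>1\<close>, and \<open>a\<close> has
  a derivative \<open>A\<close>, the Hessian of \<open>f\<close>.\<close>
locale spacelike_graph =
  fixes S :: "'n::finite minkowski set" and f :: "real ^ 'n \<Rightarrow> real"
    and a :: "real ^ 'n \<Rightarrow> real ^ 'n" and A :: "real ^ 'n \<Rightarrow> real ^ 'n \<Rightarrow> real ^ 'n"
  assumes graph: "S = {(x, t). t = f x}"
    and f': "(f has_derivative (\<lambda>v. a x \<bullet> v)) (at x)"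
    and a': "(a has_derivative A x) (at x)"
    and slope: "norm (a x) < 1"
    and tangent: "tangent_space S (x, f x) = range (\<lambda>v. (v, a x \<bullet> v))"
begin

definition T :: "real ^ 'n \<Rightarrow> 'n minkowski set" where "T x = range (\<lambda>v. (v, a x \<bullet> v))"

text \<open>The Lorentz factor of the normal, that is, of an observer with velocity \<open>a x\<close>.\<close>
definition w :: "real ^ 'n \<Rightarrow> real" where "w x = 1 / sqrt (1 - a x \<bullet> a x)"

definition \<nu> :: "real ^ 'n \<Rightarrow> 'n minkowski" where "\<nu> x = w x *\<^sub>R (a x, 1)"

lemma slope2: "a x \<bullet> a x < 1"
  using slope[of x] by (simp add: power2_norm_eq_inner[symmetric] abs_square_less_1)

lemma w_pos: "w x > 0" and w2: "(w x)\<^sup>2 * (1 - a x \<bullet> a x) = 1"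
  using slope2[of x] by (auto simp: w_def power_divide)

lemma mink_\<nu>: "mink (\<nu> x) (\<nu> x) = -1"
  using w2[of x] by (simp add: \<nu>_def mink_def algebra_simps power2_eq_square)

lemma mink_\<nu>_left: "mink (\<nu> x) X = w x * (a x \<bullet> fst X - snd X)"
  by (simp add: \<nu>_def mink_def algebra_simps)

lemma in_T_iff: "X \<in> T x \<longleftrightarrow> snd X = a x \<bullet> fst X"
  by (cases X) (auto simp: T_def)

lemma in_T_iff_mink: "X \<in> T x \<longleftrightarrow> mink (\<nu> x) X = 0"
  using w_pos[of x] by (auto simp: in_T_iff mink_\<nu>_left)

lemma subspace_T: "subspace (T x)"
  unfolding T_def
  by (intro linear_subspace_image subspace_UNIV) (auto intro!: linearI simp: inner_right_distrib)

lemma future_unit_normal_eq: "future_unit_normal S (x, f x) = \<nu> x"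
  unfolding future_unit_normal_def
proof (rule the_equality)
  show "mink (\<nu> x) (\<nu> x) = - 1 \<and> future_directed (\<nu> x) \<and>
      (\<forall>v\<in>tangent_space S (x, f x). mink (\<nu> x) v = 0)"
  proof (intro conjI ballI)
    show "mink (\<nu> x) (\<nu> x) = - 1" by (rule mink_\<nu>)
    show "future_directed (\<nu> x)" using w_pos[of x] by (simp add: future_directed_def \<nu>_def)
    show "mink (\<nu> x) v = 0" if "v \<in> tangent_space S (x, f x)" for v
      using that by (auto simp: tangent mink_\<nu>_left)
  qed
next
  fix N assume N: "mink N N = - 1 \<and> future_directed N \<and>
      (\<forall>v\<in>tangent_space S (x, f x). mink N v = 0)"
  then have "fst N \<bullet> v = (snd N *\<^sub>R a x) \<bullet> v" for v
    by (auto simp: tangent mink_def)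
  then have 1: "fst N = snd N *\<^sub>R a x" using vector_eq_rdot by blast
  have "(snd N)\<^sup>2 * (1 - a x \<bullet> a x) = 1"
    using N by (simp add: mink_def 1 power2_eq_square algebra_simps)
  with w2[of x] slope2[of x] have "(snd N)\<^sup>2 = (w x)\<^sup>2"
    by (metis less_irrefl mult_cancel_right right_minus_eq)
  then have "snd N = w x" using N w_pos[of x] by (simp add: future_directed_def)
  then show "N = \<nu> x" using 1 by (simp add: \<nu>_def prod_eq_iff)
qed

lemma w_differentiable: "\<exists>w'. (w has_derivative w') (at x)"
  unfolding w_def[abs_def] using slope2[of x]
  by (intro exI) (auto intro!: derivative_eq_intros a' refl)

lemma \<nu>_differentiable: "\<exists>d\<nu>. (\<nu> has_derivative d\<nu>) (at x)"
proof -
  obtain w' where "(w has_derivative w') (at x)" using w_differentiable by blast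
  then show ?thesis unfolding \<nu>_def[abs_def]
    using has_derivative_scaleR[OF _ has_derivative_Pair[OF a' has_derivative_const]] by blast
qed

text \<open>Both identities come from differentiating constant Minkowski products: \<open>\<langle>\<nu>, \<nu>\<rangle> = -1\<close>, and
  \<open>\<langle>\<nu>, (u, a \<bullet> u)\<rangle> = 0\<close> for a fixed \<open>u\<close>.  The second one is the shape operator in graph coordinates.\<close>
lemma derivative_\<nu>:
  assumes "(\<nu> has_derivative d\<nu>) (at x)"
  shows "mink (\<nu> x) (d\<nu> v) = 0" "mink (d\<nu> v) (u, a x \<bullet> u) = w x * (A x v \<bullet> u)"
proof -
  have "((\<lambda>x. mink (\<nu> x) (\<nu> x)) has_derivative (\<lambda>v. mink (\<nu> x) (d\<nu> v) + mink (d\<nu> v) (\<nu> x))) (at x)"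
    by (rule mink.FDERIV[OF assms assms])
  moreover have "((\<lambda>x. mink (\<nu> x) (\<nu> x)) has_derivative (\<lambda>v. 0)) (at x)"
    by (simp add: mink_\<nu>)
  ultimately have "(\<lambda>v. mink (\<nu> x) (d\<nu> v) + mink (d\<nu> v) (\<nu> x)) = (\<lambda>v. 0)"
    by (rule has_derivative_unique)
  from fun_cong[OF this, of v] show "mink (\<nu> x) (d\<nu> v) = 0" by (simp add: mink_commute)
  have "((\<lambda>y. (u, a y \<bullet> u)) has_derivative (\<lambda>v. (0, A x v \<bullet> u))) (at x)"
    by (auto intro!: derivative_eq_intros a')
  from mink.FDERIV[OF assms this]
  have "((\<lambda>y. mink (\<nu> y) (u, a y \<bullet> u)) has_derivative
      (\<lambda>v. mink (\<nu> x) (0, A x v \<bullet> u) + mink (d\<nu> v) (u, a x \<bullet> u))) (at x)" .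
  moreover have "((\<lambda>y. mink (\<nu> y) (u, a y \<bullet> u)) has_derivative (\<lambda>v. 0)) (at x)"
    by (simp add: mink_\<nu>_left)
  ultimately have "(\<lambda>v. mink (\<nu> x) (0, A x v \<bullet> u) + mink (d\<nu> v) (u, a x \<bullet> u)) = (\<lambda>v. 0)"
    by (rule has_derivative_unique)
  from fun_cong[OF this, of v] show "mink (d\<nu> v) (u, a x \<bullet> u) = w x * (A x v \<bullet> u)"
    by (simp add: mink_\<nu>_left)
qed

text \<open>The derivative of the normal within \<open>S\<close> is an arbitrarily chosen linear map.  Composing with the
  lift of a straight line to \<open>S\<close> shows that it agrees with the derivative of \<open>\<nu>\<close> on tangent vectors.\<close>
lemma frechet_derivative_normal_tangential:
  assumes d\<nu>: "(\<nu> has_derivative d\<nu>) (at x)"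
  defines "L \<equiv> frechet_derivative (future_unit_normal S) (at (x, f x) within S)"
  shows "linear L" "L (v, a x \<bullet> v) = d\<nu> v"
proof -
  have "((\<lambda>q. \<nu> (fst q)) has_derivative (\<lambda>V. d\<nu> (fst V))) (at (x, f x) within S)"
    by (rule has_derivative_compose[of fst fst]) (auto intro!: derivative_eq_intros d\<nu>)
  then have "(future_unit_normal S has_derivative (\<lambda>V. d\<nu> (fst V))) (at (x, f x) within S)"
    by (rule has_derivative_transform[rotated 2])
      (auto simp: graph future_unit_normal_eq[unfolded graph])
  then have L: "(future_unit_normal S has_derivative L) (at (x, f x) within S)"
    unfolding L_def by (metis differentiableI frechet_derivative_works)
  then show "linear L" by (rule has_derivative_linear)
  define c where "c t = (x + t *\<^sub>R v, f (x + t *\<^sub>R v))" for t :: real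
  have l: "((\<lambda>t. x + t *\<^sub>R v) has_derivative (\<lambda>t. t *\<^sub>R v)) (at 0)"
    by (auto intro!: derivative_eq_intros)
  have c: "(c has_derivative (\<lambda>t. (t *\<^sub>R v, a x \<bullet> (t *\<^sub>R v)))) (at 0)"
    unfolding c_def[abs_def]
    by (rule has_derivative_Pair[OF l has_derivative_compose[OF l]]) (simp add: f')
  have "range c \<subseteq> S" by (auto simp: c_def graph)
  then have "(future_unit_normal S has_derivative L) (at (c 0) within range c)"
    using has_derivative_subset[OF L] by (simp add: c_def)
  from has_derivative_in_compose[OF c this]
  have "((\<lambda>t. future_unit_normal S (c t)) has_derivative (\<lambda>t. L (t *\<^sub>R v, a x \<bullet> (t *\<^sub>R v)))) (at 0)" .
  moreover have "((\<lambda>t. future_unit_normal S (c t)) has_derivative (\<lambda>t. d\<nu> (t *\<^sub>R v))) (at 0)"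
    unfolding c_def future_unit_normal_eq by (rule has_derivative_compose[OF l]) (simp add: d\<nu>)
  ultimately have "(\<lambda>t. L (t *\<^sub>R v, a x \<bullet> (t *\<^sub>R v))) = (\<lambda>t. d\<nu> (t *\<^sub>R v))"
    by (rule has_derivative_unique)
  from fun_cong[OF this, of 1] show "L (v, a x \<bullet> v) = d\<nu> v" by simp
qed

text \<open>In every orthonormal frame \<open>U\<close> of the tangent space, \<open>n\<close> times the mean curvature is the sum of the
  diagonal entries of the second fundamental form, which is \<open>w\<close> times the Hessian.\<close>
lemma mean_curvature_eq_sum:
  assumes I: "finite I" "\<And>i. i \<in> I \<Longrightarrow> U i \<in> T x"
    and expand: "\<And>X. X \<in> T x \<Longrightarrow> X = (\<Sum>i\<in>I. mink X (U i) *\<^sub>R U i)"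
  shows "real CARD('n) * mean_curvature S (x, f x) = w x * (\<Sum>i\<in>I. A x (fst (U i)) \<bullet> fst (U i))"
proof -
  obtain d\<nu> where d\<nu>: "(\<nu> has_derivative d\<nu>) (at x)" using \<nu>_differentiable by blast
  define L where "L = frechet_derivative (future_unit_normal S) (at (x, f x) within S)"
  have L: "linear L" "\<And>v. L (v, a x \<bullet> v) = d\<nu> v"
    unfolding L_def by (rule frechet_derivative_normal_tangential[OF d\<nu>])+
  have "L ` T x \<subseteq> T x"
  proof
    fix Y assume "Y \<in> L ` T x"
    then obtain v where "Y = d\<nu> v" unfolding T_def using L(2) by auto
    then show "Y \<in> T x" using derivative_\<nu>(1)[OF d\<nu>] by (simp add: in_T_iff_mink)
  qed
  then have "trace_on (T x) L = (\<Sum>i\<in>I. mink (L (U i)) (U i))"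
    using trace_on_eq_sum[of "T x" L I U "\<lambda>i X. mink X (U i)"] subspace_T L(1) I expand
      bounded_linear.linear[OF mink.bounded_linear_left] by blast
  also have "\<dots> = (\<Sum>i\<in>I. w x * (A x (fst (U i)) \<bullet> fst (U i)))"
  proof (rule sum.cong[OF refl])
    fix i assume "i \<in> I"
    then have "U i = (fst (U i), a x \<bullet> fst (U i))" using I(2) in_T_iff by (metis prod.collapse)
    then show "mink (L (U i)) (U i) = w x * (A x (fst (U i)) \<bullet> fst (U i))"
      using L(2) derivative_\<nu>(2)[OF d\<nu>] by metis
  qed
  finally show ?thesis
    by (simp add: mean_curvature_def tangent T_def[symmetric] L_def sum_distrib_left[symmetric])
qed

end

lemma spacelike_graph_exists:
  fixes S :: "'n::finite minkowski set"
  assumes S: "spacelike_hypersurface S" "entire S"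
  obtains f a A where "spacelike_graph S f a A"
proof -
  obtain f where graph: "S = {(x, t). t = f x}" using S(2) unfolding entire_def by blast
  have smooth: "smooth_on UNIV f" by (rule spacelike_graph_smooth[OF S(1) graph])
  let ?D = "\<lambda>x. frechet_derivative f (at x)"
  define a where "a x = (\<Sum>b\<in>Basis. ?D x b *\<^sub>R b)" for x
  have D: "(f has_derivative ?D x) (at x)" for x
    by (rule smooth_on_has_derivative[OF smooth UNIV_I])
  have Da: "?D x v = a x \<bullet> v" for x v
  proof -
    have "?D x v = ?D x (\<Sum>b\<in>Basis. (v \<bullet> b) *\<^sub>R b)" by (simp add: euclidean_representation)
    also have "\<dots> = (\<Sum>b\<in>Basis. (v \<bullet> b) * ?D x b)"
      by (simp add: linear_sum[OF has_derivative_linear[OF D]] linear_scale[OF has_derivative_linear[OF D]])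
    finally show ?thesis by (simp add: a_def inner_sum_left inner_commute[of v] mult.commute)
  qed
  have "Ck_on 1 UNIV a"
    unfolding a_def[abs_def]
    by (intro Ck_on_sum Ck_on_linear_image[OF bounded_linear_scaleR_left]
        smooth_on_imp_Ck smooth_on_frechet_derivative smooth open_UNIV)
  then have a': "(a has_derivative frechet_derivative a (at x)) (at x)" for x
    using Ck_on_SucD[of 0 UNIV a x] by simp
  have tangent: "tangent_space S (x, f x) = range (\<lambda>v. (v, a x \<bullet> v))" for x
    using tangent_space_smooth_graph[OF smooth, of x] by (simp add: graph Da)
  have "norm (a x) < 1" for x
  proof (cases "a x = 0")
    case False
    have "(x, f x) \<in> S" "(a x, a x \<bullet> a x) \<in> tangent_space S (x, f x)"
      by (auto simp: graph tangent[unfolded graph])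
    then have "spacelike (a x, a x \<bullet> a x)"
      using S(1) False unfolding spacelike_hypersurface_def by (metis fst_conv fst_zero)
    then have "(a x \<bullet> a x) * (a x \<bullet> a x) < (a x \<bullet> a x) * 1"
      by (simp add: spacelike_def mink_def)
    then have "a x \<bullet> a x < 1" 
      using mult_less_cancel_left_pos[of "a x \<bullet> a x" "a x \<bullet> a x" 1] False by simp
    then show ?thesis by (simp add: norm_eq_sqrt_inner)
  qed simp
  then have "spacelike_graph S f a (\<lambda>x. frechet_derivative a (at x))"
    using graph D a' tangent by unfold_locales (auto simp: Da[abs_def])
  then show thesis by (rule that)
qed

section \<open>Orthonormal frames and boosts\<close>

text \<open>For future unit timelike vectors \<open>N\<close>, \<open>\<nu>\<close> the boost in the plane of \<open>N\<close> and \<open>\<nu>\<close> that maps \<open>\<nu>\<close>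
  to \<open>N\<close> acts on the orthogonal complement of \<open>\<nu>\<close> by
  \<open>X \<mapsto> X + \<langle>X, N\<rangle> / (1 + c) (N + \<nu>)\<close>, where \<open>c = -\<langle>\<nu>, N\<rangle>\<close>.  It will carry an orthonormal frame of one
  hypersurface to an orthonormal frame of the other one.\<close>
lemma boost_maps_orthogonal:
  assumes "mink N N = -1" "c = - mink \<nu> N" "1 + c \<noteq> 0"
  shows "mink (X + (mink X N / (1 + c)) *\<^sub>R (N + \<nu>)) N = 0"
proof -
  have "mink (N + \<nu>) N = - (1 + c)" using assms(1,2) by (simp add: mink.add_left)
  then show ?thesis using assms(3) by (simp add: mink.add_left mink.scaleR_left)
    (simp add: field_simps)
qed

lemma boost_isometry:
  assumes "mink N N = -1" "mink \<nu> \<nu> = -1" "c = - mink \<nu> N" "1 + c \<noteq> 0"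
    and "mink X \<nu> = 0" "mink Y \<nu> = 0"
  shows "mink (X + (mink X N / (1 + c)) *\<^sub>R (N + \<nu>)) (Y + (mink Y N / (1 + c)) *\<^sub>R (N + \<nu>)) = mink X Y"
proof -
  define M where "M = N + \<nu>"
  have M: "mink M M = - 2 * (1 + c)" "mink X M = mink X N" "mink M Y = mink Y N"
    using assms by (simp_all add: M_def mink.add_left mink.add_right mink_commute[of N \<nu>]
        mink_commute[of N Y] mink_commute[of \<nu> Y])
  have expand: "mink (X + p *\<^sub>R M) (Y + q *\<^sub>R M) =
      mink X Y + q * mink X N + p * mink Y N - 2 * p * q * (1 + c)" for p q
    by (simp add: mink.add_left mink.add_right mink.scaleR_left mink.scaleR_right M algebra_simps)
  define p q where "p = mink X N / (1 + c)" and "q = mink Y N / (1 + c)"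
  have "mink X N = p * (1 + c)" "mink Y N = q * (1 + c)"
    using assms(4) by (simp_all add: p_def q_def)
  then show ?thesis
    unfolding M_def[symmetric] p_def[symmetric] q_def[symmetric] expand by (simp add: algebra_simps)
qed

text \<open>The inverse boost is given by the same formula with \<open>N\<close> and \<open>\<nu>\<close> exchanged.\<close>
lemma boost_inverse:
  assumes "mink N N = -1" "c = - mink \<nu> N" "1 + c \<noteq> 0" "mink Y N = 0"
  defines "X \<equiv> Y + (mink Y \<nu> / (1 + c)) *\<^sub>R (N + \<nu>)"
  shows "X + (mink X N / (1 + c)) *\<^sub>R (N + \<nu>) = Y"
proof -
  have "mink (N + \<nu>) N = - (1 + c)" using assms(1,2) by (simp add: mink.add_left)
  then have "mink X N = - mink Y \<nu>"
    using assms(3,4) by (simp add: X_def mink.add_left mink.scaleR_left) (simp add: field_simps)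
  then show ?thesis by (simp add: X_def)
qed

context spacelike_graph
begin

text \<open>The image of the horizontal vector \<open>(i, 0)\<close> under the boost that maps the vertical vector
  \<open>(0, 1)\<close> to \<open>\<nu> x\<close>.\<close>
definition frame where
  "frame x i = (i + ((w x)\<^sup>2 / (1 + w x) * (a x \<bullet> i)) *\<^sub>R a x, w x * (a x \<bullet> i))"

lemma frame_coefficient:
  defines "k \<equiv> \<lambda>x. (w x)\<^sup>2 / (1 + w x)"
  shows "k x * (1 + w x) = (w x)\<^sup>2" "1 + k x * (a x \<bullet> a x) = w x"
proof -
  show 1: "k x * (1 + w x) = (w x)\<^sup>2" using w_pos[of x] by (simp add: k_def)
  have "k x * (a x \<bullet> a x) * (1 + w x) = k x * (1 + w x) * (a x \<bullet> a x)" by (simp only: mult_ac)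
  also have "\<dots> = (w x)\<^sup>2 * (a x \<bullet> a x)" unfolding 1 ..
  also have "\<dots> = (w x)\<^sup>2 - 1" using w2[of x] by (simp add: right_diff_distrib)
  also have "\<dots> = (w x - 1) * (1 + w x)" by (simp add: algebra_simps power2_eq_square)
  finally show "1 + k x * (a x \<bullet> a x) = w x" using w_pos[of x] by simp
qed

lemma frame_in_T: "frame x i \<in> T x"
proof -
  have "a x \<bullet> fst (frame x i) = (1 + (w x)\<^sup>2 / (1 + w x) * (a x \<bullet> a x)) * (a x \<bullet> i)"
    by (simp add: frame_def inner_add_right algebra_simps)
  then show ?thesis unfolding frame_coefficient(2) in_T_iff by (simp add: frame_def)
qed

lemma frame_unit:
  assumes "i \<in> Basis"
  shows "mink (frame x i) (frame x i) = 1"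
proof -
  define k s t where "k = (w x)\<^sup>2 / (1 + w x)" and "s = a x \<bullet> a x" and "t = a x \<bullet> i"
  have k: "k * (1 + w x) = (w x)\<^sup>2" "1 + k * s = w x"
    unfolding k_def s_def by (rule frame_coefficient)+
  have F: "frame x i = (i + (k * t) *\<^sub>R a x, w x * t)" by (simp add: frame_def k_def t_def)
  have "mink (frame x i) (frame x i) = 1 + 2 * k * t\<^sup>2 + k\<^sup>2 * t\<^sup>2 * s - (w x)\<^sup>2 * t\<^sup>2"
    using assms
    by (simp add: F mink_def s_def[symmetric] t_def[symmetric] inner_add_left inner_add_right
        inner_commute[of i "a x"] power2_eq_square algebra_simps)
  also have "\<dots> = 1 + (k * (1 + (1 + k * s)) - (w x)\<^sup>2) * t\<^sup>2"
    by algebra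
  finally show ?thesis unfolding k(2) k(1) by simp
qed

lemma frame_expand:
  assumes X: "X \<in> T x"
  shows "X = (\<Sum>i\<in>Basis. mink X (frame x i) *\<^sub>R frame x i)"
proof -
  define k s \<xi> where "k = (w x)\<^sup>2 / (1 + w x)" and "s = a x \<bullet> a x" and "\<xi> = fst X"
  have k: "k * (1 + w x) = (w x)\<^sup>2" "1 + k * s = w x"
    unfolding k_def s_def by (rule frame_coefficient)+
  have X: "X = (\<xi>, a x \<bullet> \<xi>)" using X by (simp add: in_T_iff \<xi>_def prod_eq_iff)
  define \<eta> where "\<eta> = \<xi> + ((k - w x) * (a x \<bullet> \<xi>)) *\<^sub>R a x"
  have coeff: "mink X (frame x i) = \<eta> \<bullet> i" for i
    by (simp add: X mink_def frame_def k_def[symmetric] \<eta>_def inner_add_left inner_add_right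
        inner_commute[of \<xi>] algebra_simps)
  have ws: "w x * (w x * (1 - s)) = 1" using w2[of x] by (simp add: s_def power2_eq_square algebra_simps)
  have "a x \<bullet> \<eta> = (1 + k * s - w x * s) * (a x \<bullet> \<xi>)"
    by (simp add: \<eta>_def s_def inner_add_right algebra_simps)
  then have a\<eta>: "a x \<bullet> \<eta> = w x * (1 - s) * (a x \<bullet> \<xi>)"
    unfolding k(2) by (simp add: algebra_simps)
  have kk: "k - w x + k * (w x * (1 - s)) = 0"
  proof -
    have "w x * (k - w x + k * (w x * (1 - s))) = w x * k - w x * w x + k * (w x * (w x * (1 - s)))"
      by (simp add: algebra_simps)
    then have "w x * (k - w x + k * (w x * (1 - s))) = k * (1 + w x) - (w x)\<^sup>2"
      unfolding ws by (simp add: algebra_simps power2_eq_square)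
    then show ?thesis using k(1) w_pos[of x] by simp
  qed
  have "(\<Sum>i\<in>Basis. (\<eta> \<bullet> i) *\<^sub>R (i + (k * (a x \<bullet> i)) *\<^sub>R a x)) = \<eta> + (k * (a x \<bullet> \<eta>)) *\<^sub>R a x"
    by (simp add: scaleR_add_right sum.distrib euclidean_representation scaleR_sum_left[symmetric]
        euclidean_inner[of "a x" \<eta>] sum_distrib_left mult_ac)
  also have "\<dots> = \<xi> + ((k - w x + k * (w x * (1 - s))) * (a x \<bullet> \<xi>)) *\<^sub>R a x"
    by (simp add: \<eta>_def[symmetric] a\<eta>) (simp add: \<eta>_def algebra_simps)
  finally have 1: "(\<Sum>i\<in>Basis. (\<eta> \<bullet> i) *\<^sub>R (i + (k * (a x \<bullet> i)) *\<^sub>R a x)) = \<xi>"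
    unfolding kk by simp
  have "(\<Sum>i\<in>Basis. (\<eta> \<bullet> i) * (w x * (a x \<bullet> i))) = w x * (a x \<bullet> \<eta>)"
    by (simp add: euclidean_inner[of "a x" \<eta>] sum_distrib_left mult_ac)
  also have "\<dots> = a x \<bullet> \<xi>" using ws by (simp add: a\<eta> mult.assoc[symmetric])
  finally have 2: "(\<Sum>i\<in>Basis. (\<eta> \<bullet> i) * (w x * (a x \<bullet> i))) = a x \<bullet> \<xi>" .
  show ?thesis
    unfolding coeff using 1 2
    by (simp add: X prod_eq_iff fst_sum snd_sum frame_def k_def[symmetric])
qed

text \<open>Parseval's identity for the part of \<open>X\<close> tangential to the hypersurface.\<close>
lemma frame_sum_squares:
  "(\<Sum>i\<in>Basis. (mink X (frame x i))\<^sup>2) = mink X X + (mink X (\<nu> x))\<^sup>2"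
proof -
  define Y where "Y = X + mink X (\<nu> x) *\<^sub>R \<nu> x"
  have "mink (\<nu> x) Y = 0"
    by (simp add: Y_def mink.add_right mink.scaleR_right mink_\<nu> mink_commute[of "\<nu> x" X])
  then have Y: "Y \<in> T x" by (simp add: in_T_iff_mink)
  have XY: "mink X (frame x i) = mink Y (frame x i)" for i
    using frame_in_T[of x i] by (simp add: Y_def mink.add_left mink.scaleR_left in_T_iff_mink)
  have "mink Y Y = mink Y (\<Sum>i\<in>Basis. mink Y (frame x i) *\<^sub>R frame x i)"
    using frame_expand[OF Y] by simp
  also have "\<dots> = (\<Sum>i\<in>Basis. (mink X (frame x i))\<^sup>2)"
    by (simp add: mink.sum_right mink.scaleR_right XY power2_eq_square)
  finally show ?thesis
    by (simp add: Y_def mink.add_left mink.add_right mink.scaleR_left mink.scaleR_right mink_\<nu>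
        mink_commute[of "\<nu> x" X] power2_eq_square)
qed

lemma mean_curvature_frame:
  "real CARD('n) * mean_curvature S (x, f x) =
    w x * (\<Sum>i\<in>Basis. A x (fst (frame x i)) \<bullet> fst (frame x i))"
  by (rule mean_curvature_eq_sum[OF finite_Basis frame_in_T frame_expand])

lemma f_line: "((\<lambda>t. f (x + t *\<^sub>R v)) has_real_derivative a (x + t *\<^sub>R v) \<bullet> v) (at t)"
proof -
  have "((\<lambda>t. x + t *\<^sub>R v) has_derivative (\<lambda>t. t *\<^sub>R v)) (at t)"
    by (auto intro!: derivative_eq_intros)
  from has_derivative_compose[OF this f'] show ?thesis
    by (simp add: has_field_derivative_def mult.commute[of _ "_ \<bullet> _"])
qed

lemma a_line: "((\<lambda>t. a (x + t *\<^sub>R v) \<bullet> u) has_real_derivative A (x + t *\<^sub>R v) v \<bullet> u) (at t)"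
proof -
  have "((\<lambda>t. x + t *\<^sub>R v) has_derivative (\<lambda>t. t *\<^sub>R v)) (at t)"
    by (auto intro!: derivative_eq_intros)
  from has_derivative_inner_left[OF has_derivative_compose[OF this a'], of u] show ?thesis
    by (simp add: has_field_derivative_def linear_scale[OF has_derivative_linear[OF a']]
        mult.commute[of _ "_ \<bullet> _"])
qed

lemma strictly_lipschitz:
  assumes "x \<noteq> y"
  shows "\<bar>f x - f y\<bar> < norm (x - y)"
proof -
  obtain s where "f (y + 1 *\<^sub>R (x - y)) - f (y + 0 *\<^sub>R (x - y)) = (1 - 0) * (a (y + s *\<^sub>R (x - y)) \<bullet> (x - y))"
    using MVT2[OF zero_less_one, of "\<lambda>t. f (y + t *\<^sub>R (x - y))", OF f_line] by blast
  then have "\<bar>f x - f y\<bar> = \<bar>a (y + s *\<^sub>R (x - y)) \<bullet> (x - y)\<bar>" by simp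
  also have "\<dots> \<le> norm (a (y + s *\<^sub>R (x - y))) * norm (x - y)" by (rule Cauchy_Schwarz_ineq2)
  also have "\<dots> < 1 * norm (x - y)" using slope assms by (intro mult_strict_right_mono) auto
  finally show ?thesis by simp
qed

lemma lipschitz: "\<bar>f x - f y\<bar> \<le> norm (x - y)"
  using strictly_lipschitz[of x y] by (cases "x = y") auto

lemma continuous_f: "continuous_on UNIV f"
  by (intro continuous_at_imp_continuous_on ballI has_derivative_continuous[OF f'])

text \<open>The Minkowski square of the separation between two points of the graph.\<close>
definition z where "z x0 x = (norm (x - x0))\<^sup>2 - (f x - f x0)\<^sup>2"

lemma z_nonneg: "z x0 x \<ge> 0"
  using lipschitz[of x x0] power_mono[of "\<bar>f x - f x0\<bar>" "norm (x - x0)" 2] by (simp add: z_def)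

text \<open>By compactness \<open>\<bar>f x - f x0\<bar> \<le> 1 - c\<close> on the unit sphere around \<open>x0\<close>, for some \<open>c > 0\<close>.  Along each
  ray from \<open>x0\<close> the defect \<open>\<bar>x - x0\<bar> - \<bar>f x - f x0\<bar>\<close> is at least \<open>c\<close> from then on, since \<open>f\<close> is
  \<open>1\<close>-Lipschitz, and one factor of \<open>z = (\<bar>x - x0\<bar> - \<bar>f x - f x0\<bar>) (\<bar>x - x0\<bar> + \<bar>f x - f x0\<bar>)\<close> is thus
  at least \<open>c\<close>, the other one at least \<open>\<bar>x - x0\<bar>\<close>.\<close>
lemma z_proper:
  obtains c where "c > 0" "\<And>x. norm (x - x0) \<ge> 1 \<Longrightarrow> c * norm (x - x0) \<le> z x0 x"
proof -
  have "x0 + (SOME i. i \<in> Basis) \<in> sphere x0 1" by (simp add: dist_norm SOME_Basis)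
  then have "sphere x0 1 \<noteq> {}" by (metis empty_iff)
  moreover have "continuous_on (sphere x0 1) (\<lambda>x. \<bar>f x - f x0\<bar>)"
    by (intro continuous_intros continuous_on_subset[OF continuous_f]) auto
  ultimately obtain y where y: "y \<in> sphere x0 1" "\<And>x. x \<in> sphere x0 1 \<Longrightarrow> \<bar>f x - f x0\<bar> \<le> \<bar>f y - f x0\<bar>"
    using continuous_attains_sup[OF compact_sphere] by metis
  define c where "c = 1 - \<bar>f y - f x0\<bar>"
  have "y \<noteq> x0" "norm (y - x0) = 1" using y(1) by (auto simp: dist_norm norm_minus_commute)
  then have c: "0 < c" "c \<le> 1" using strictly_lipschitz[of y x0] by (auto simp: c_def)
  have main: "c * r \<le> z x0 x" if r: "r = norm (x - x0)" "r \<ge> 1" for x r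
  proof -
    define e where "e = x0 + (1 / r) *\<^sub>R (x - x0)"
    have "x \<noteq> x0" using r by auto
    then have "e \<in> sphere x0 1" using r by (simp add: e_def dist_norm)
    then have "\<bar>f e - f x0\<bar> \<le> 1 - c" using y(2) by (simp add: c_def)
    moreover have "norm (x - e) = r - 1"
    proof -
      have "x - e = (1 - 1 / r) *\<^sub>R (x - x0)" by (simp add: e_def algebra_simps)
      then have "norm (x - e) = \<bar>1 - 1 / r\<bar> * r" unfolding r(1) by (simp only: norm_scaleR real_norm_def)
      moreover have "\<bar>1 - 1 / r\<bar> = 1 - 1 / r" using r(2) by simp
      moreover have "(1 - 1 / r) * r = r - 1" using r(2) by (simp add: left_diff_distrib)
      ultimately show ?thesis by (simp only:)
    qed
    then have "\<bar>f x - f e\<bar> \<le> r - 1" using lipschitz[of x e] by simp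
    ultimately have "\<bar>f x - f x0\<bar> \<le> r - c" by linarith
    then have "(f x - f x0)\<^sup>2 \<le> (r - c)\<^sup>2"
      using power_mono[of "\<bar>f x - f x0\<bar>" "r - c" 2] by simp
    then have "z x0 x \<ge> r\<^sup>2 - (r - c)\<^sup>2" by (simp add: z_def r(1))
    moreover have "r\<^sup>2 - (r - c)\<^sup>2 = c * r + c * (r - c)" by (simp add: power2_eq_square algebra_simps)
    moreover have "0 \<le> c * (r - c)" using c r(2) by simp
    ultimately show ?thesis by linarith
  qed
  show thesis by (rule that[OF c(1) main[OF refl]])
qed

end

section \<open>The penalised Lorentzian distance between two graphs\<close>

lemma second_derivative_test:
  fixes g :: "real \<Rightarrow> real"
  assumes g': "\<And>t. (g has_real_derivative g' t) (at t)"
    and g'': "(g' has_real_derivative D) (at 0)"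
    and max: "\<forall>\<^sub>F t in at 0. g t \<le> g 0"
  shows "g' 0 = 0" "D \<le> 0"
proof -
  obtain d where d: "d > 0" "\<And>t. t \<noteq> 0 \<Longrightarrow> \<bar>t\<bar> < d \<Longrightarrow> g t \<le> g 0"
    using max unfolding eventually_at by (auto simp: dist_real_def)
  have "g y \<le> g 0" if "\<bar>0 - y\<bar> < d" for y
    using d(2)[of y] that by (cases "y = 0") auto
  then show 0: "g' 0 = 0" by (intro DERIV_local_max[OF g' d(1)] allI impI)
  show "D \<le> 0"
  proof (rule ccontr)
    assume "\<not> D \<le> 0"
    then obtain e where e: "e > 0" "\<And>h. 0 < h \<Longrightarrow> h < e \<Longrightarrow> g' 0 < g' (0 + h)"
      using DERIV_pos_inc_right[OF g''] by auto
    define t where "t = min d e / 2"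
    have t: "0 < t" "t < d" "t < e" using d(1) e(1) by (auto simp: t_def)
    obtain s where s: "0 < s" "s < t" "g t - g 0 = (t - 0) * g' s"
      using MVT2[OF t(1), of g g'] g' by blast
    have "g' s > 0" using e(2)[of s] s t 0 by simp
    then have "g t > g 0" using s(3) t(1) by (simp add: zero_less_mult_iff algebra_simps)
    then show False using d(2)[of t] t by simp
  qed
qed

locale spacelike_pair =
  S1: spacelike_graph S\<^sub>1 f\<^sub>1 a\<^sub>1 A\<^sub>1 + S2: spacelike_graph S\<^sub>2 f\<^sub>2 a\<^sub>2 A\<^sub>2
  for S\<^sub>1 S\<^sub>2 :: "'n::finite minkowski set" and f\<^sub>1 f\<^sub>2 a\<^sub>1 a\<^sub>2 A\<^sub>1 A\<^sub>2
begin

text \<open>The squared Lorentzian distance of the points of the two graphs above \<open>x\<close> and \<open>y\<close>, minus a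
  penalty that forces a maximum to exist.  The logarithm is chosen because of its concavity: for
  constant mean curvature its Laplacian stays bounded above, and even so after adding a multiple of
  its squared gradient.\<close>
definition \<Phi> where
  "\<Phi> \<epsilon> x\<^sub>0 x y = (f\<^sub>1 y - f\<^sub>2 x)\<^sup>2 - (norm (y - x))\<^sup>2 - \<epsilon> * ln (1 + S2.z x\<^sub>0 x)"

text \<open>First and second derivative of \<open>\<Phi>\<close> along a line in the two coordinate domains, written with
  the tangent vectors \<open>V\<close>, \<open>U\<close> of the two hypersurfaces that project to \<open>v\<close>, \<open>u\<close>.\<close>
lemma variation_along_line:
  fixes \<epsilon> x\<^sub>0 x y u v
  assumes max: "\<forall>\<^sub>F t in at 0. \<Phi> \<epsilon> x\<^sub>0 (x + t *\<^sub>R v) (y + t *\<^sub>R u) \<le> \<Phi> \<epsilon> x\<^sub>0 x y"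
  defines "Q \<equiv> (y - x, f\<^sub>1 y - f\<^sub>2 x)" and "P \<equiv> (x - x\<^sub>0, f\<^sub>2 x - f\<^sub>2 x\<^sub>0)"
    and "U \<equiv> (u, a\<^sub>1 y \<bullet> u)" and "V \<equiv> (v, a\<^sub>2 x \<bullet> v)" and "e \<equiv> \<epsilon> / (1 + S2.z x\<^sub>0 x)"
  shows "mink Q (U - V) + e * mink P V = 0"
    and "- 2 * mink (U - V) (U - V) + 2 * snd Q * (A\<^sub>1 y u \<bullet> u) - 2 * (snd Q - e * snd P) * (A\<^sub>2 x v \<bullet> v)
        - 2 * e * mink V V + \<epsilon> * (2 * mink P V / (1 + S2.z x\<^sub>0 x))\<^sup>2 \<le> 0"
proof -
  define h h' where "h t = f\<^sub>1 (y + t *\<^sub>R u) - f\<^sub>2 (x + t *\<^sub>R v)"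
    and "h' t = a\<^sub>1 (y + t *\<^sub>R u) \<bullet> u - a\<^sub>2 (x + t *\<^sub>R v) \<bullet> v" for t
  define k k' where "k t = f\<^sub>2 (x + t *\<^sub>R v) - f\<^sub>2 x\<^sub>0" and "k' t = a\<^sub>2 (x + t *\<^sub>R v) \<bullet> v" for t
  define d where "d t = (y - x) \<bullet> (y - x) + 2 * t * ((y - x) \<bullet> (u - v)) + t\<^sup>2 * ((u - v) \<bullet> (u - v))" for t
  define d' where "d' t = 2 * ((y - x) \<bullet> (u - v)) + 2 * t * ((u - v) \<bullet> (u - v))" for t
  define q where "q t = (x - x\<^sub>0) \<bullet> (x - x\<^sub>0) + 2 * t * ((x - x\<^sub>0) \<bullet> v) + t\<^sup>2 * (v \<bullet> v) - (k t)\<^sup>2" for t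
  define q' where "q' t = 2 * ((x - x\<^sub>0) \<bullet> v) + 2 * t * (v \<bullet> v) - 2 * k t * k' t" for t
  have h: "(h has_real_derivative h' t) (at t)" for t
    unfolding h_def[abs_def] h'_def by (intro DERIV_diff S1.f_line S2.f_line)
  have h2: "(h' has_real_derivative A\<^sub>1 y u \<bullet> u - A\<^sub>2 x v \<bullet> v) (at 0)"
    unfolding h'_def[abs_def]
    using DERIV_diff[OF S1.a_line[of y u u 0] S2.a_line[of x v v 0]] by simp
  have k: "(k has_real_derivative k' t) (at t)" for t
    unfolding k_def[abs_def] k'_def using DERIV_diff[OF S2.f_line DERIV_const] by simp
  have k2: "(k' has_real_derivative A\<^sub>2 x v \<bullet> v) (at 0)"
    unfolding k'_def[abs_def] using S2.a_line[of x v v 0] by simp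
  have d: "(d has_real_derivative d' t) (at t)" for t
    unfolding d_def[abs_def] d'_def by (auto intro!: derivative_eq_intros)
  have d2: "(d' has_real_derivative 2 * ((u - v) \<bullet> (u - v))) (at t)" for t
    unfolding d'_def[abs_def] by (auto intro!: derivative_eq_intros)
  have q: "(q has_real_derivative q' t) (at t)" for t
    unfolding q_def[abs_def] q'_def by (auto intro!: derivative_eq_intros k)
  have q2: "(q' has_real_derivative 2 * (v \<bullet> v) - 2 * (k' 0)\<^sup>2 - 2 * k 0 * (A\<^sub>2 x v \<bullet> v)) (at 0)"
    unfolding q'_def[abs_def]
    by (rule derivative_eq_intros k k2 refl)+ (simp add: power2_eq_square)
  have q_eq: "q t = S2.z x\<^sub>0 (x + t *\<^sub>R v)" for t
    unfolding q_def S2.z_def k_def power2_norm_eq_inner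
    by (simp add: algebra_simps inner_commute power2_eq_square)
  have q_pos: "1 + q t > 0" for t using S2.z_nonneg[of x\<^sub>0 "x + t *\<^sub>R v"] by (simp add: q_eq)
  define g g' where "g t = (h t)\<^sup>2 - d t - \<epsilon> * ln (1 + q t)"
    and "g' t = 2 * h t * h' t - d' t - \<epsilon> * (q' t / (1 + q t))" for t
  have g: "(g has_real_derivative g' t) (at t)" for t
    unfolding g_def[abs_def] g'_def using q_pos[of t]
    by (auto intro!: derivative_eq_intros h d q simp: divide_inverse)
  define D where "D = 2 * (v \<bullet> v) - 2 * (k' 0)\<^sup>2 - 2 * k 0 * (A\<^sub>2 x v \<bullet> v)"
  have "((\<lambda>t. q' t / (1 + q t)) has_real_derivative
      (D * (1 + q 0) - q' 0 * q' 0) / ((1 + q 0) * (1 + q 0))) (at 0)"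
    using q_pos[of 0] unfolding D_def
    by (intro DERIV_divide q2) (auto intro!: derivative_eq_intros q)
  moreover have "(D * (1 + q 0) - q' 0 * q' 0) / ((1 + q 0) * (1 + q 0)) = D / (1 + q 0) - (q' 0 / (1 + q 0))\<^sup>2"
    using q_pos[of 0] by (simp add: diff_divide_distrib power_divide power2_eq_square)
  ultimately have quot: "((\<lambda>t. q' t / (1 + q t)) has_real_derivative
      D / (1 + q 0) - (q' 0 / (1 + q 0))\<^sup>2) (at 0)"
    by (simp only:)
  have "((\<lambda>t. 2 * h t * h' t) has_real_derivative
      2 * (h' 0)\<^sup>2 + 2 * h 0 * (A\<^sub>1 y u \<bullet> u - A\<^sub>2 x v \<bullet> v)) (at 0)"
    by (rule derivative_eq_intros h h2 refl)+ (simp add: power2_eq_square algebra_simps)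
  from DERIV_diff[OF DERIV_diff[OF this d2] DERIV_cmult[OF quot]]
  have g2: "(g' has_real_derivative 2 * (h' 0)\<^sup>2 + 2 * h 0 * (A\<^sub>1 y u \<bullet> u - A\<^sub>2 x v \<bullet> v)
      - 2 * ((u - v) \<bullet> (u - v)) - \<epsilon> * (D / (1 + q 0) - (q' 0 / (1 + q 0))\<^sup>2)) (at 0)"
    unfolding g'_def[abs_def] .
  have g_eq: "g t = \<Phi> \<epsilon> x\<^sub>0 (x + t *\<^sub>R v) (y + t *\<^sub>R u)" for t
  proof -
    have "d t = (norm (y + t *\<^sub>R u - (x + t *\<^sub>R v)))\<^sup>2"
      unfolding d_def power2_norm_eq_inner
      by (simp add: algebra_simps inner_commute power2_eq_square)
    then show ?thesis by (simp add: g_def \<Phi>_def h_def q_eq)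
  qed
  have "\<forall>\<^sub>F t in at 0. g t \<le> g 0" using max by (simp add: g_eq)
  note test = second_derivative_test[OF g g2 this]
  have m1: "mink Q (U - V) = d' 0 / 2 - h 0 * h' 0" and m2: "mink P V = q' 0 / 2"
    and m3: "mink (U - V) (U - V) = (u - v) \<bullet> (u - v) - (h' 0)\<^sup>2"
    and m4: "mink V V = v \<bullet> v - (k' 0)\<^sup>2" and m5: "snd Q = h 0" and m6: "snd P = k 0"
    and m7: "1 + S2.z x\<^sub>0 x = 1 + q 0"
    by (simp_all add: mink_def Q_def U_def V_def P_def d'_def h_def h'_def q'_def k_def k'_def q_eq
        power2_eq_square)
  show "mink Q (U - V) + e * mink P V = 0"
    using test(1) unfolding m1 m2 e_def m7 g'_def by (simp add: field_simps)
  have "- 2 * mink (U - V) (U - V) + 2 * snd Q * (A\<^sub>1 y u \<bullet> u) - 2 * (snd Q - e * snd P) * (A\<^sub>2 x v \<bullet> v)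
        - 2 * e * mink V V + \<epsilon> * (2 * mink P V / (1 + S2.z x\<^sub>0 x))\<^sup>2 =
      2 * (h' 0)\<^sup>2 + 2 * h 0 * (A\<^sub>1 y u \<bullet> u - A\<^sub>2 x v \<bullet> v)
      - 2 * ((u - v) \<bullet> (u - v))
      - \<epsilon> * (D / (1 + q 0) - (q' 0 / (1 + q 0))\<^sup>2)"
    unfolding m2 m3 m4 m5 m6 m7 e_def D_def by (simp add: algebra_simps diff_divide_distrib add_divide_distrib)
  with test(2) show "- 2 * mink (U - V) (U - V) + 2 * snd Q * (A\<^sub>1 y u \<bullet> u)
        - 2 * (snd Q - e * snd P) * (A\<^sub>2 x v \<bullet> v)
        - 2 * e * mink V V + \<epsilon> * (2 * mink P V / (1 + S2.z x\<^sub>0 x))\<^sup>2 \<le> 0"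
    by simp
qed

text \<open>This is focusing towards the past of a hypersurface of positive mean curvature.  At a point
  \<open>(y, f\<^sub>1 y)\<close> that is farthest from a fixed point in the past the joining segment is \<open>\<tau>\<close> times the
  normal, and tracing the second variation over an orthonormal frame gives \<open>2n\<tau>H - 2n \<le> 0\<close> for the
  mean curvature \<open>H\<close> at that point.\<close>
lemma timelike_separation_bound:
  fixes x y
  assumes max: "\<And>u. \<forall>\<^sub>F t in at 0. \<Phi> 0 x x (y + t *\<^sub>R u) \<le> \<Phi> 0 x x y"
  defines "\<tau> \<equiv> (f\<^sub>1 y - f\<^sub>2 x) / S1.w y"
  shows "(f\<^sub>1 y - f\<^sub>2 x)\<^sup>2 - (norm (y - x))\<^sup>2 = \<tau>\<^sup>2" "\<tau> * mean_curvature S\<^sub>1 (y, f\<^sub>1 y) \<le> 1"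
proof -
  define h where "h = f\<^sub>1 y - f\<^sub>2 x"
  note var = variation_along_line[of 0 x x 0 y, simplified, OF max, folded h_def]
  have "(y - x) \<bullet> u = (h *\<^sub>R a\<^sub>1 y) \<bullet> u" for u
    using var(1)[of u] by (simp add: mink_def h_def)
  then have yx: "y - x = h *\<^sub>R a\<^sub>1 y" using vector_eq_rdot by blast
  have "(S1.w y)\<^sup>2 * (h\<^sup>2 * (1 - a\<^sub>1 y \<bullet> a\<^sub>1 y)) = h\<^sup>2" using S1.w2[of y] by algebra
  then show "(f\<^sub>1 y - f\<^sub>2 x)\<^sup>2 - (norm (y - x))\<^sup>2 = \<tau>\<^sup>2"
    using S1.w_pos[of y] unfolding yx \<tau>_def h_def[symmetric] power2_norm_eq_inner power_divide
    by (simp add: field_simps power2_eq_square)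
  have le: "h * (A\<^sub>1 y (fst (S1.frame y i)) \<bullet> fst (S1.frame y i)) \<le> 1" if "i \<in> Basis" for i
  proof -
    have F: "S1.frame y i = (fst (S1.frame y i), a\<^sub>1 y \<bullet> fst (S1.frame y i))"
      using S1.frame_in_T[of y i] S1.in_T_iff by (metis prod.collapse)
    have "mink (fst (S1.frame y i), a\<^sub>1 y \<bullet> fst (S1.frame y i))
        (fst (S1.frame y i), a\<^sub>1 y \<bullet> fst (S1.frame y i)) = 1"
      using S1.frame_unit[OF that, of y] F by simp
    then have "2 * h * (A\<^sub>1 y (fst (S1.frame y i)) \<bullet> fst (S1.frame y i)) \<le> 2"
      using var(2)[of "fst (S1.frame y i)"] by (simp add: zero_prod_def[symmetric] mink_def h_def)
    then show ?thesis by simp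
  qed
  have "\<tau> * (real CARD('n) * mean_curvature S\<^sub>1 (y, f\<^sub>1 y)) =
      (\<Sum>i\<in>Basis. h * (A\<^sub>1 y (fst (S1.frame y i)) \<bullet> fst (S1.frame y i)))"
    unfolding S1.mean_curvature_frame \<tau>_def h_def[symmetric]
    using S1.w_pos[of y] by (simp add: sum_distrib_left)
  also have "\<dots> \<le> (\<Sum>i\<in>(Basis :: (real ^ 'n) set). 1)" by (rule sum_mono[OF le])
  also have "\<dots> = real CARD('n)" by simp
  finally have "real CARD('n) * (\<tau> * mean_curvature S\<^sub>1 (y, f\<^sub>1 y)) \<le> real CARD('n) * 1" by (simp add: mult_ac)
  then show "\<tau> * mean_curvature S\<^sub>1 (y, f\<^sub>1 y) \<le> 1"
    by (subst (asm) mult_le_cancel_left_pos) simp_all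
qed

text \<open>At an interior maximum of \<open>\<Phi>\<close> the first variation says that the separation \<open>Q\<close> is \<open>\<tau>\<close> times the normal
  \<open>N\<close> of the upper hypersurface, and that \<open>Q - eP\<close> is normal to the lower one; in particular the tilt
  \<open>c\<close> between the two normals is controlled by the gradient of the penalty.  In the second variation
  the lower point moves along an orthonormal frame \<open>V\<^sub>i\<close> and the upper point along \<open>l\<close> times the
  boosted frame \<open>U\<^sub>i\<close>.  Summing over \<open>i\<close> turns the Hessians into mean curvatures, and \<open>l > 1\<close> will
  exploit that \<open>H\<^sub>1 > 0\<close>.\<close>
lemma trace_of_second_variation:
  fixes \<epsilon> x\<^sub>0 x y
  assumes max: "\<And>u v. \<forall>\<^sub>F t in at 0. \<Phi> \<epsilon> x\<^sub>0 (x + t *\<^sub>R v) (y + t *\<^sub>R u) \<le> \<Phi> \<epsilon> x\<^sub>0 x y"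
    and "\<epsilon> > 0"
  defines "\<tau> \<equiv> (f\<^sub>1 y - f\<^sub>2 x) / S1.w y" and "e \<equiv> \<epsilon> / (1 + S2.z x\<^sub>0 x)"
    and "n \<equiv> real CARD('n)"
  obtains c \<omega> where "c \<ge> 1" "(f\<^sub>1 y - f\<^sub>2 x)\<^sup>2 - (norm (y - x))\<^sup>2 = \<tau>\<^sup>2"
    "e\<^sup>2 * (S2.z x\<^sub>0 x + \<omega>\<^sup>2) = \<tau>\<^sup>2 * (c\<^sup>2 - 1)"
    "\<And>l. - 2 * n * (l - 1)\<^sup>2 + 4 * l * (c - 1)
        + 2 * n * (\<tau> * l\<^sup>2 * mean_curvature S\<^sub>1 (y, f\<^sub>1 y)
          - (\<tau> * c + e * \<omega>) * mean_curvature S\<^sub>2 (x, f\<^sub>2 x))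
        - 2 * n * e + 4 / \<epsilon> * (\<tau>\<^sup>2 * (c\<^sup>2 - 1)) \<le> 0"
proof -
  define Q P where "Q = (y - x, f\<^sub>1 y - f\<^sub>2 x)" and "P = (x - x\<^sub>0, f\<^sub>2 x - f\<^sub>2 x\<^sub>0)"
  define N \<nu> where "N = S1.\<nu> y" and "\<nu> = S2.\<nu> x"
  define c \<omega> where "c = - mink \<nu> N" and "\<omega> = mink P \<nu>"
  define V where "V i = S2.frame x i" for i
  define U where "U i = V i + (mink (V i) N / (1 + c)) *\<^sub>R (N + \<nu>)" for i
  define Z where "Z = S2.z x\<^sub>0 x"
  have NN: "mink N N = -1" "mink \<nu> \<nu> = -1" unfolding N_def \<nu>_def by (rule S1.mink_\<nu> S2.mink_\<nu>)+
  have Z: "1 + Z > 0" "mink P P = Z"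
    using S2.z_nonneg[of x\<^sub>0 x]
    by (auto simp: Z_def S2.z_def P_def mink_def power2_norm_eq_inner power2_eq_square[of "_ - _"])
  \<comment> \<open>the first variation determines the directions of \<open>Q\<close> and of \<open>Q - e P\<close>\<close>
  have first: "mink Q (U - V) + e * mink P V = 0" if "U \<in> S1.T y" "V \<in> S2.T x" for U V
    using variation_along_line(1)[OF max[of "fst V" "fst U"]] that
    unfolding S1.in_T_iff S2.in_T_iff Q_def P_def e_def by (metis prod.collapse)
  have Q_T: "mink Q U = 0" if "U \<in> S1.T y" for U
    using first[OF that, of 0] by (simp add: S2.in_T_iff mink.zero_right)
  have QP_T: "mink Q V = e * mink P V" if "V \<in> S2.T x" for V
    using first[OF _ that, of 0] by (simp add: S1.in_T_iff mink.zero_right mink.diff_right mink.minus_right)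
  have Q: "Q = \<tau> *\<^sub>R N"
  proof -
    have "(y - x) \<bullet> u = ((f\<^sub>1 y - f\<^sub>2 x) *\<^sub>R a\<^sub>1 y) \<bullet> u" for u
      using Q_T[of "(u, a\<^sub>1 y \<bullet> u)"] by (simp add: S1.in_T_iff Q_def mink_def)
    then have "y - x = (f\<^sub>1 y - f\<^sub>2 x) *\<^sub>R a\<^sub>1 y" using vector_eq_rdot by blast
    then show ?thesis using S1.w_pos[of y] by (simp add: Q_def \<tau>_def N_def S1.\<nu>_def)
  qed
  have "mink Q Q = - \<tau>\<^sup>2"
    by (simp add: Q mink.scaleR_left mink.scaleR_right NN power2_eq_square)
  then have W: "(f\<^sub>1 y - f\<^sub>2 x)\<^sup>2 - (norm (y - x))\<^sup>2 = \<tau>\<^sup>2"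
    unfolding power2_norm_eq_inner by (simp add: Q_def mink_def power2_eq_square)
  have R: "snd Q - e * snd P = (\<tau> * c + e * \<omega>) * S2.w x"
  proof -
    define R where "R = Q - e *\<^sub>R P"
    have "fst R \<bullet> v = (snd R *\<^sub>R a\<^sub>2 x) \<bullet> v" for v
      using QP_T[of "(v, a\<^sub>2 x \<bullet> v)"]
      by (simp add: S2.in_T_iff R_def mink_def inner_diff_left algebra_simps)
    then have "fst R = snd R *\<^sub>R a\<^sub>2 x" using vector_eq_rdot by blast
    then have "R = (snd R / S2.w x) *\<^sub>R \<nu>"
      using S2.w_pos[of x] by (simp add: \<nu>_def S2.\<nu>_def prod_eq_iff)
    then have "mink R \<nu> = - (snd R / S2.w x)"
      using NN(2) mink.scaleR_left[of "snd R / S2.w x" \<nu> \<nu>] by simp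
    moreover have "mink R \<nu> = - (\<tau> * c + e * \<omega>)"
      by (simp add: R_def Q mink.diff_left mink.scaleR_left c_def \<omega>_def mink_commute[of N \<nu>])
    ultimately have "snd R / S2.w x = \<tau> * c + e * \<omega>" by linarith
    then have "snd R = (\<tau> * c + e * \<omega>) * S2.w x" using S2.w_pos[of x] by (simp add: divide_eq_eq)
    then show ?thesis by (simp add: R_def)
  qed
  \<comment> \<open>the second variation moves the two end points along corresponding frames\<close>
  have V: "V i \<in> S2.T x" "mink (V i) \<nu> = 0" for i
    using S2.frame_in_T[of x i] S2.in_T_iff_mink[of "V i" x]
    by (simp_all add: V_def \<nu>_def mink_commute)
  have V1: "mink (V i) (V i) = 1" if "i \<in> Basis" for i
    using S2.frame_unit[OF that] by (simp add: V_def)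
  have sumVN: "(\<Sum>i\<in>Basis. (mink (V i) N)\<^sup>2) = c\<^sup>2 - 1"
    using S2.frame_sum_squares[of N x]
    by (simp add: V_def NN c_def \<nu>_def[symmetric] mink_commute[of N \<nu>]
        mink_commute[of "S2.frame x _" N])
  have sumVP: "(\<Sum>i\<in>Basis. (mink P (V i))\<^sup>2) = Z + \<omega>\<^sup>2"
    using S2.frame_sum_squares[of P x] by (simp add: V_def Z \<omega>_def \<nu>_def)
  have c1: "c \<ge> 1"
  proof -
    have "a\<^sub>2 x \<bullet> a\<^sub>1 y \<le> norm (a\<^sub>2 x) * norm (a\<^sub>1 y)" by (rule norm_cauchy_schwarz)
    also have "\<dots> \<le> 1 * 1" using S1.slope[of y] S2.slope[of x] by (intro mult_mono) auto
    finally have "c \<ge> 0"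
      using S1.w_pos[of y] S2.w_pos[of x]
      by (simp add: c_def \<nu>_def N_def S2.mink_\<nu>_left S1.\<nu>_def algebra_simps)
    moreover have "c\<^sup>2 - 1 \<ge> 0" unfolding sumVN[symmetric] by (rule sum_nonneg) simp
    ultimately show ?thesis using power2_le_imp_le[of 1 c] by simp
  qed
  then have c0: "1 + c \<noteq> 0" by simp
  have U: "U i \<in> S1.T y" for i
    using boost_maps_orthogonal[OF NN(1) c_def c0, of "V i"]
    by (simp add: S1.in_T_iff_mink U_def N_def mink_commute)
  have U_iso: "mink (U i) (U j) = mink (V i) (V j)" for i j
    unfolding U_def by (rule boost_isometry[OF NN c_def c0 V(2) V(2)])
  have U_expand: "Y = (\<Sum>i\<in>Basis. mink Y (U i) *\<^sub>R U i)" if Y: "Y \<in> S1.T y" for Y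
  proof -
    define b where "b = (\<lambda>X. X + (mink X N / (1 + c)) *\<^sub>R (N + \<nu>))"
    have lin: "linear b"
      unfolding b_def
      by (rule linearI) (simp_all add: mink.add_left mink.scaleR_left add_divide_distrib
          scaleR_add_left scaleR_add_right)
    have YN: "mink Y N = 0" using Y by (simp add: S1.in_T_iff_mink N_def mink_commute)
    define X where "X = Y + (mink Y \<nu> / (1 + c)) *\<^sub>R (N + \<nu>)"
    have bX: "b X = Y" unfolding b_def X_def by (rule boost_inverse[OF NN(1) c_def c0 YN])
    have "mink (N + \<nu>) \<nu> = - (1 + c)"
      by (simp add: mink.add_left NN c_def mink_commute[of N \<nu>])
    then have X\<nu>: "mink X \<nu> = 0"
      using c0 by (simp add: X_def mink.add_left[of Y] mink.scaleR_left) (simp add: field_simps)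
    then have XT: "X \<in> S2.T x" by (simp add: S2.in_T_iff_mink \<nu>_def mink_commute)
    have "Y = b (\<Sum>i\<in>Basis. mink X (V i) *\<^sub>R V i)"
      using S2.frame_expand[OF XT] by (simp add: V_def bX)
    also have "\<dots> = (\<Sum>i\<in>Basis. mink X (V i) *\<^sub>R b (V i))"
      by (simp add: linear_sum[OF lin] linear_scale[OF lin])
    also have "\<dots> = (\<Sum>i\<in>Basis. mink Y (U i) *\<^sub>R U i)"
    proof (rule sum.cong[OF refl])
      fix i
      have "mink (b X) (b (V i)) = mink X (V i)"
        unfolding b_def by (rule boost_isometry[OF NN c_def c0 X\<nu> V(2)])
      moreover have "b (V i) = U i" by (simp add: b_def U_def)
      ultimately show "mink X (V i) *\<^sub>R b (V i) = mink Y (U i) *\<^sub>R U i" by (simp add: bX)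
    qed
    finally show ?thesis .
  qed
  have H1: "n * mean_curvature S\<^sub>1 (y, f\<^sub>1 y) = S1.w y * (\<Sum>i\<in>Basis. A\<^sub>1 y (fst (U i)) \<bullet> fst (U i))"
    unfolding n_def by (rule S1.mean_curvature_eq_sum[OF finite_Basis U U_expand])
  have H2: "n * mean_curvature S\<^sub>2 (x, f\<^sub>2 x) = S2.w x * (\<Sum>i\<in>Basis. A\<^sub>2 x (fst (V i)) \<bullet> fst (V i))"
    unfolding n_def V_def by (rule S2.mean_curvature_frame)
  have mVU: "mink (V i) (U i) = 1 + (mink (V i) N)\<^sup>2 / (1 + c)" if "i \<in> Basis" for i
    by (simp add: U_def mink.add_right mink.scaleR_right V(2) V1[OF that] power2_eq_square)
  have tang: "e\<^sup>2 * (Z + \<omega>\<^sup>2) = \<tau>\<^sup>2 * (c\<^sup>2 - 1)"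
  proof -
    have "(e * mink P (V i))\<^sup>2 = \<tau>\<^sup>2 * (mink (V i) N)\<^sup>2" for i
      unfolding QP_T[OF V(1), symmetric]
      by (simp add: Q mink.scaleR_left mink_commute[of N "V _"] power_mult_distrib)
    then have "(\<Sum>i\<in>Basis. (e * mink P (V i))\<^sup>2) = \<tau>\<^sup>2 * (c\<^sup>2 - 1)"
      by (simp add: sum_distrib_left[symmetric] sumVN)
    then show ?thesis
      by (simp add: power_mult_distrib sum_distrib_left[symmetric] sumVP)
  qed
  have "- 2 * n * (l - 1)\<^sup>2 + 4 * l * (c - 1)
        + 2 * n * (\<tau> * l\<^sup>2 * mean_curvature S\<^sub>1 (y, f\<^sub>1 y)
          - (\<tau> * c + e * \<omega>) * mean_curvature S\<^sub>2 (x, f\<^sub>2 x))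
        - 2 * n * e + 4 / \<epsilon> * (\<tau>\<^sup>2 * (c\<^sup>2 - 1)) \<le> 0" for l
  proof -
    define \<alpha> \<beta> where "\<alpha> i = A\<^sub>1 y (fst (U i)) \<bullet> fst (U i)" and "\<beta> i = A\<^sub>2 x (fst (V i)) \<bullet> fst (V i)" for i
    have each: "- 2 * (l - 1)\<^sup>2 + 4 * l / (1 + c) * (mink (V i) N)\<^sup>2 + 2 * l\<^sup>2 * snd Q * \<alpha> i
        - 2 * (snd Q - e * snd P) * \<beta> i - 2 * e + 4 / \<epsilon> * e\<^sup>2 * (mink P (V i))\<^sup>2 \<le> 0"
      if i: "i \<in> Basis" for i
    proof -
      have lU: "l *\<^sub>R U i \<in> S1.T y" using U S1.subspace_T subspace_scale by blast
      have Ui: "(fst (l *\<^sub>R U i), a\<^sub>1 y \<bullet> fst (l *\<^sub>R U i)) = l *\<^sub>R U i"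
        using lU unfolding S1.in_T_iff by (metis prod.collapse)
      have Vi: "(fst (V i), a\<^sub>2 x \<bullet> fst (V i)) = V i"
        using V(1)[of i] unfolding S2.in_T_iff by (metis prod.collapse)
      have A: "A\<^sub>1 y (fst (l *\<^sub>R U i)) \<bullet> fst (l *\<^sub>R U i) = l\<^sup>2 * \<alpha> i"
        by (simp add: \<alpha>_def linear_scale[OF has_derivative_linear[OF S1.a']] power2_eq_square)
      have D: "mink (l *\<^sub>R U i - V i) (l *\<^sub>R U i - V i) = (l - 1)\<^sup>2 - 2 * l / (1 + c) * (mink (V i) N)\<^sup>2"
        by (simp add: mink.diff_left mink.diff_right mink.scaleR_left mink.scaleR_right U_iso V1[OF i]
            mink_commute[of "U i" "V i"] mVU[OF i] power2_eq_square algebra_simps)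
      have E: "\<epsilon> * (2 * mink P (V i) / (1 + S2.z x\<^sub>0 x))\<^sup>2 = 4 / \<epsilon> * e\<^sup>2 * (mink P (V i))\<^sup>2"
        using \<open>\<epsilon> > 0\<close> Z(1) by (simp add: e_def Z_def[symmetric] field_simps power2_eq_square)
      show ?thesis
        using variation_along_line(2)[OF max[of "fst (V i)" "fst (l *\<^sub>R U i)"]]
        unfolding Ui Vi A Q_def[symmetric] P_def[symmetric] e_def[symmetric] D E V1[OF i] \<beta>_def[symmetric]
        by (simp add: algebra_simps)
    qed
    have s0: "(\<Sum>i\<in>(Basis :: (real ^ 'n) set). - 2 * (l - 1)\<^sup>2 + 4 * l / (1 + c) * (mink (V i) N)\<^sup>2 + 2 * l\<^sup>2 * snd Q * \<alpha> i
        - 2 * (snd Q - e * snd P) * \<beta> i - 2 * e + 4 / \<epsilon> * e\<^sup>2 * (mink P (V i))\<^sup>2) =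
      n * (- 2 * (l - 1)\<^sup>2) + 4 * l / (1 + c) * (c\<^sup>2 - 1) + 2 * l\<^sup>2 * snd Q * (\<Sum>i\<in>Basis. \<alpha> i)
        - 2 * (snd Q - e * snd P) * (\<Sum>i\<in>Basis. \<beta> i) - n * (2 * e) + 4 / \<epsilon> * e\<^sup>2 * (Z + \<omega>\<^sup>2)"
      unfolding sumVN[symmetric] sumVP[symmetric] sum_distrib_left n_def
      by (simp add: sum.distrib sum_subtractf)
    have e1: "4 * l / (1 + c) * (c\<^sup>2 - 1) = 4 * l * (c - 1)"
    proof -
      have "c\<^sup>2 - 1 = (1 + c) * (c - 1)" by (simp add: power2_eq_square algebra_simps)
      then show ?thesis using c0 by simp
    qed
    have e2: "snd Q * (\<Sum>i\<in>Basis. \<alpha> i) = n * \<tau> * mean_curvature S\<^sub>1 (y, f\<^sub>1 y)"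
    proof -
      have "snd Q = \<tau> * S1.w y" using S1.w_pos[of y] by (simp add: Q_def \<tau>_def)
      then show ?thesis using H1 by (simp add: \<alpha>_def mult_ac)
    qed
    have e3: "(snd Q - e * snd P) * (\<Sum>i\<in>Basis. \<beta> i) =
        n * (\<tau> * c + e * \<omega>) * mean_curvature S\<^sub>2 (x, f\<^sub>2 x)"
      unfolding R using H2 by (simp add: \<beta>_def mult_ac)
    have e4: "4 / \<epsilon> * e\<^sup>2 * (Z + \<omega>\<^sup>2) = 4 / \<epsilon> * (\<tau>\<^sup>2 * (c\<^sup>2 - 1))"
      using tang by (simp add: mult.assoc)
    have "(\<Sum>i\<in>(Basis :: (real ^ 'n) set). - 2 * (l - 1)\<^sup>2 + 4 * l / (1 + c) * (mink (V i) N)\<^sup>2 + 2 * l\<^sup>2 * snd Q * \<alpha> i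
        - 2 * (snd Q - e * snd P) * \<beta> i - 2 * e + 4 / \<epsilon> * e\<^sup>2 * (mink P (V i))\<^sup>2) \<le> 0"
      by (rule sum_nonpos) (rule each)
    then have "n * (- 2 * (l - 1)\<^sup>2) + 4 * l * (c - 1) + 2 * l\<^sup>2 * (n * \<tau> * mean_curvature S\<^sub>1 (y, f\<^sub>1 y))
        - 2 * (n * (\<tau> * c + e * \<omega>) * mean_curvature S\<^sub>2 (x, f\<^sub>2 x)) - n * (2 * e)
        + 4 / \<epsilon> * (\<tau>\<^sup>2 * (c\<^sup>2 - 1)) \<le> 0"
      unfolding s0 e1[symmetric] e2[symmetric] e3[symmetric] e4[symmetric] by (simp only: mult.assoc)
    then show ?thesis by (simp add: algebra_simps)
  qed
  then show thesis using that[OF c1 W] tang by (simp add: Z_def)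
qed

end

section \<open>The comparison principle\<close>

text \<open>With \<open>l = 1 + h H\<^sub>1\<close> the mean curvature terms exceed the cost \<open>2n(l - 1)\<^sup>2\<close> of the dilation by a fixed
  positive amount.  The remaining negative terms are either of order \<open>\<epsilon>\<close> or are absorbed by
  \<open>4\<tau>\<^sup>2(c\<^sup>2 - 1)/\<epsilon>\<close>, which comes from the concavity of the logarithm in the penalty.\<close>
lemma comparison_arithmetic:
  fixes n h H\<^sub>1 H\<^sub>2 H \<tau> c \<omega> e \<epsilon> z :: real
  assumes pos: "n > 0" "h > 0" "H\<^sub>1 > 0" "\<epsilon> > 0"
    and H: "H\<^sub>2 \<le> H\<^sub>1" "H\<^sub>1 \<le> H" and \<tau>: "h \<le> \<tau>" and c: "1 \<le> c" and z: "0 \<le> z" and e: "e \<le> \<epsilon>"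
    and small: "n * \<bar>H\<^sub>2\<bar> * \<epsilon> \<le> 2 * h" "\<epsilon> * (2 * n + n\<^sup>2 * H\<^sub>2\<^sup>2 / 2) < 2 * n * (h * H\<^sub>1)\<^sup>2"
    and tang: "e\<^sup>2 * (z + \<omega>\<^sup>2) = \<tau>\<^sup>2 * (c\<^sup>2 - 1)"
    and l: "l = 1 + h * H\<^sub>1"
  shows "- 2 * n * (l - 1)\<^sup>2 + 4 * l * (c - 1)
        + 2 * n * (\<tau> * l\<^sup>2 * H - (\<tau> * c + e * \<omega>) * H\<^sub>2)
        - 2 * n * e + 4 / \<epsilon> * (\<tau>\<^sup>2 * (c\<^sup>2 - 1)) > 0"
proof -
  define \<delta> K where "\<delta> = h * H\<^sub>1" and "K = \<tau>\<^sup>2 * (c\<^sup>2 - 1)"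
  have \<delta>: "\<delta> > 0" "l = 1 + \<delta>" using pos by (simp_all add: \<delta>_def l)
  have "\<tau> > 0" using \<tau> pos by simp
  \<comment> \<open>one half of \<open>4K/\<epsilon>\<close> pays for the tilt of the normals\<close>
  have 1: "2 / \<epsilon> * K \<ge> 2 * n * \<tau> * (c - 1) * H\<^sub>2"
  proof -
    have "2 * h * (\<tau> * (c - 1)) \<le> \<tau> * (\<tau> * (c - 1)) * 2"
      using mult_right_mono[OF \<tau>, of "\<tau> * (c - 1)"] \<open>\<tau> > 0\<close> c by simp
    also have "\<dots> \<le> \<tau> * (\<tau> * (c - 1)) * (c + 1)"
      using \<open>\<tau> > 0\<close> c by (intro mult_left_mono) auto
    also have "\<dots> = K" by (simp add: K_def power2_eq_square algebra_simps)
    finally have "2 * h * (\<tau> * (c - 1)) \<le> K" .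
    moreover have "n * \<bar>H\<^sub>2\<bar> * \<epsilon> * (\<tau> * (c - 1)) \<le> 2 * h * (\<tau> * (c - 1))"
      using small(1) \<open>\<tau> > 0\<close> c by (intro mult_right_mono) auto
    moreover have "n * H\<^sub>2 * \<epsilon> * (\<tau> * (c - 1)) \<le> n * \<bar>H\<^sub>2\<bar> * \<epsilon> * (\<tau> * (c - 1))"
      using pos \<open>\<tau> > 0\<close> c by (intro mult_right_mono mult_left_mono) auto
    ultimately have "n * H\<^sub>2 * (\<tau> * (c - 1)) * \<epsilon> \<le> K" by (simp add: mult_ac)
    then have "n * H\<^sub>2 * (\<tau> * (c - 1)) \<le> K / \<epsilon>" using pos by (simp add: pos_le_divide_eq)
    moreover have "2 * n * \<tau> * (c - 1) * H\<^sub>2 = 2 * (n * H\<^sub>2 * (\<tau> * (c - 1)))" by (simp only: mult_ac)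
    moreover have "2 / \<epsilon> * K = 2 * (K / \<epsilon>)" by simp
    ultimately show ?thesis by linarith
  qed
  \<comment> \<open>the other half pays for the mean curvature term of the penalty\<close>
  have 2: "2 / \<epsilon> * K - 2 * n * (e * \<omega>) * H\<^sub>2 \<ge> - (\<epsilon> * (n\<^sup>2 * H\<^sub>2\<^sup>2 / 2))"
  proof -
    have "(e * \<omega>)\<^sup>2 \<le> K"
      unfolding K_def tang[symmetric] using z by (simp add: power_mult_distrib distrib_left)
    then have "2 / \<epsilon> * (e * \<omega>)\<^sup>2 \<le> 2 / \<epsilon> * K" using pos by (intro mult_left_mono) auto
    moreover have "0 \<le> 2 / \<epsilon> * (e * \<omega> - n * H\<^sub>2 * \<epsilon> / 2)\<^sup>2" using pos by simp
    moreover have "2 / \<epsilon> * (e * \<omega> - n * H\<^sub>2 * \<epsilon> / 2)\<^sup>2 =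
        2 / \<epsilon> * (e * \<omega>)\<^sup>2 - 2 * n * (e * \<omega>) * H\<^sub>2 + \<epsilon> * (n\<^sup>2 * H\<^sub>2\<^sup>2 / 2)"
      using pos by (simp add: field_simps power2_eq_square)
    ultimately show ?thesis by linarith
  qed
  have 3: "\<tau> * l\<^sup>2 * H - \<tau> * H\<^sub>2 \<ge> 2 * \<delta>\<^sup>2"
  proof -
    have "\<tau> * l\<^sup>2 * H\<^sub>1 \<le> \<tau> * l\<^sup>2 * H" "\<tau> * H\<^sub>2 \<le> \<tau> * H\<^sub>1"
      using \<open>\<tau> > 0\<close> H by (auto intro!: mult_left_mono)
    moreover have "\<tau> * l\<^sup>2 * H\<^sub>1 - \<tau> * H\<^sub>1 = 2 * \<delta> * (\<tau> * H\<^sub>1) + \<tau> * H\<^sub>1 * \<delta>\<^sup>2"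
      by (simp add: \<delta>(2) power2_eq_square algebra_simps)
    moreover have "\<delta> \<le> \<tau> * H\<^sub>1" unfolding \<delta>_def using \<tau> pos by (intro mult_right_mono) auto
    then have "2 * \<delta> * \<delta> \<le> 2 * \<delta> * (\<tau> * H\<^sub>1)" using \<delta> by (intro mult_left_mono) auto
    moreover have "0 \<le> \<tau> * H\<^sub>1 * \<delta>\<^sup>2" using pos \<open>\<tau> > 0\<close> by simp
    ultimately show ?thesis by (simp add: power2_eq_square)
  qed
  have 4: "2 * n * (2 * \<delta>\<^sup>2) \<le> 2 * n * (\<tau> * l\<^sup>2 * H - \<tau> * H\<^sub>2)"
    using 3 pos by (intro mult_left_mono) auto
  have 5: "n * e \<le> n * \<epsilon>" using e pos by (intro mult_left_mono) auto
  have 6: "0 \<le> 4 * l * (c - 1)" using \<delta> c by simp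
  have "- 2 * n * (l - 1)\<^sup>2 + 4 * l * (c - 1)
        + 2 * n * (\<tau> * l\<^sup>2 * H - (\<tau> * c + e * \<omega>) * H\<^sub>2) - 2 * n * e + 4 / \<epsilon> * K =
      - 2 * n * \<delta>\<^sup>2 + 4 * l * (c - 1) + 2 * n * (\<tau> * l\<^sup>2 * H - \<tau> * H\<^sub>2) - 2 * (n * e)
        + (2 / \<epsilon> * K - 2 * n * \<tau> * (c - 1) * H\<^sub>2) + (2 / \<epsilon> * K - 2 * n * (e * \<omega>) * H\<^sub>2)"
    by (simp add: \<delta>(2) algebra_simps)
  moreover have "\<epsilon> * (2 * n) + \<epsilon> * (n\<^sup>2 * H\<^sub>2\<^sup>2 / 2) < 2 * n * \<delta>\<^sup>2"
    using small(2) by (simp add: \<delta>_def distrib_left)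
  ultimately show ?thesis unfolding K_def[symmetric] using 1 2 4 5 6 by (simp add: mult_ac)
qed

context spacelike_graph
begin

text \<open>If a future null ray never rises above the graph, then the whole null line lies strictly below it, because
  \<open>f(x + s e) - s\<close> is strictly decreasing in \<open>s\<close>.  The line is thus an inextendable causal curve that
  misses the hypersurface.\<close>
lemma null_ray_leaves_domain_of_dependence:
  assumes e: "norm e = 1" and below: "\<And>s. s \<ge> 0 \<Longrightarrow> s0 + s \<le> f (x + s *\<^sub>R e)"
  shows "(x, s0) \<notin> domain_of_dependence S"
proof
  assume dom: "(x, s0) \<in> domain_of_dependence S"
  define \<gamma> where "\<gamma> t = x + (t - s0) *\<^sub>R e" for t
  let ?C = "range (\<lambda>t. (\<gamma> t, t))"
  have diff: "\<gamma> t - \<gamma> s = (t - s) *\<^sub>R e" for t s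
    by (simp add: \<gamma>_def algebra_simps)
  have "1-lipschitz_on UNIV \<gamma>"
    by (rule lipschitz_onI) (simp_all add: dist_norm diff e)
  moreover have "causal_curve ?C"
    unfolding causal_curve_def
  proof (intro conjI exI ballI impI)
    show "is_interval (UNIV :: real set)" by simp
    show "continuous_on UNIV (\<lambda>t. (\<gamma> t, t))"
      unfolding \<gamma>_def by (intro continuous_intros)
    fix p q assume "p \<in> ?C" "q \<in> ?C"
    then obtain s t where "p = (\<gamma> s, s)" "q = (\<gamma> t, t)" by blast
    then have "mink (q - p) (q - p) = (t - s) * (t - s) * (e \<bullet> e) - (t - s) * (t - s)"
      by (simp add: mink_def diff)
    also have "e \<bullet> e = 1" using e by (simp add: power2_norm_eq_inner[symmetric])
    finally show "timelike (q - p) \<or> null_vector (q - p)"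
      by (simp add: null_vector_def)
  qed simp
  ultimately have "inextendable_causal_curve ?C"
    unfolding inextendable_causal_curve_def by blast
  moreover have "(x, s0) \<in> ?C" by (rule range_eqI[of _ _ s0]) (simp add: \<gamma>_def)
  ultimately have "?C \<inter> S \<noteq> {}" using dom unfolding domain_of_dependence_def by blast
  then obtain t where "(\<gamma> t, t) \<in> S" by blast
  then have t: "t = f (\<gamma> t)" by (simp add: graph)
  define s where "s = max 0 (t - s0) + 1"
  have s: "s \<ge> 0" "s > t - s0" by (auto simp: s_def)
  have d: "\<gamma> (s0 + s) - \<gamma> t = (s0 + s - t) *\<^sub>R e" by (rule diff)
  have "norm (\<gamma> (s0 + s) - \<gamma> t) = s0 + s - t" unfolding d using e s by simp
  moreover from this have "\<gamma> (s0 + s) \<noteq> \<gamma> t" using s by auto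
  ultimately have "\<bar>f (\<gamma> (s0 + s)) - f (\<gamma> t)\<bar> < s0 + s - t"
    using strictly_lipschitz[of "\<gamma> (s0 + s)" "\<gamma> t"] by simp
  then have "f (\<gamma> (s0 + s)) < s0 + s" using t by linarith
  then show False using below[OF s(1)] by (simp add: \<gamma>_def)
qed

end

context spacelike_pair
begin

text \<open>If points of \<open>S\<^sub>1\<close> in the causal future of points of \<open>S\<^sub>2\<close> over a compact set escaped to infinity,
  the directions towards them would accumulate at a direction \<open>e\<close>, and the null ray in direction \<open>e\<close>
  from some point of \<open>S\<^sub>2\<close> would never rise above \<open>S\<^sub>1\<close>.\<close>
lemma cone_bounded:
  assumes dom: "S\<^sub>2 \<subseteq> domain_of_dependence S\<^sub>1" and C: "compact C"
  shows "bounded {(x, y). x \<in> C \<and> norm (y - x) \<le> f\<^sub>1 y - f\<^sub>2 x}"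
proof (rule ccontr)
  let ?X = "{(x, y). x \<in> C \<and> norm (y - x) \<le> f\<^sub>1 y - f\<^sub>2 x}"
  assume unb: "\<not> bounded ?X"
  obtain B where B: "\<And>x. x \<in> C \<Longrightarrow> norm x \<le> B"
    using compact_imp_bounded[OF C] unfolding bounded_iff by blast
  have "\<exists>p. p \<in> ?X \<and> norm (snd p - fst p) > real k" for k
  proof (rule ccontr)
    assume no: "\<nexists>p. p \<in> ?X \<and> norm (snd p - fst p) > real k"
    have "norm p \<le> B + (B + real k)" if "p \<in> ?X" for p
    proof -
      have "norm (snd p) \<le> norm (fst p) + norm (snd p - fst p)"
        using norm_triangle_sub by blast
      moreover have "norm (fst p) \<le> B" "norm (snd p - fst p) \<le> real k"
        using that no B by (auto simp: not_less)
      moreover have "norm p \<le> norm (fst p) + norm (snd p)"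
        by (cases p) (simp add: norm_Pair_le)
      ultimately show ?thesis by linarith
    qed
    then show False using unb unfolding bounded_iff by blast
  qed
  then have "\<forall>k. \<exists>p. p \<in> ?X \<and> norm (snd p - fst p) > real k" by blast
  from choice[OF this] obtain p
    where p0: "\<forall>k. p k \<in> ?X \<and> norm (snd (p k) - fst (p k)) > real k" ..
  note p = conjunct1[OF spec[OF p0]] conjunct2[OF spec[OF p0]]
  define X Y d E where "X k = fst (p k)" and "Y k = snd (p k)" and "d k = norm (Y k - X k)"
    and "E k = (1 / d k) *\<^sub>R (Y k - X k)" for k
  have X: "X k \<in> C" "d k \<le> f\<^sub>1 (Y k) - f\<^sub>2 (X k)" "d k > real k" "d k > 0" for k
    using p[of k] by (auto simp: X_def Y_def d_def case_prod_beta simp del: zero_less_norm_iff)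
  have E: "norm (E k) = 1" for k
    using X(4)[of k] by (simp add: E_def d_def)
  have YX: "Y k = X k + d k *\<^sub>R E k" for k
    using X(4)[of k] by (simp add: E_def)
  have sc: "seq_compact (C \<times> sphere (0 :: real ^ 'n) 1)"
    using C by (intro compact_imp_seq_compact compact_Times) auto
  have mem: "\<forall>k. (X k, E k) \<in> C \<times> sphere 0 1" using X(1) E by simp
  obtain L r where L: "L \<in> C \<times> sphere 0 1" "strict_mono r"
    "((\<lambda>k. (X k, E k)) \<circ> r) \<longlonglongrightarrow> L"
    by (rule seq_compactE[OF sc mem])
  define x e where "x = fst L" and "e = snd L"
  have Xr: "(\<lambda>k. X (r k)) \<longlonglongrightarrow> x" and Er: "(\<lambda>k. E (r k)) \<longlonglongrightarrow> e"
    using tendsto_fst[OF L(3)] tendsto_snd[OF L(3)] by (simp_all add: x_def e_def o_def)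
  have e: "norm e = 1" using L(1) by (auto simp: e_def)
  have "f\<^sub>2 x + s \<le> f\<^sub>1 (x + s *\<^sub>R e)" if s: "s \<ge> 0" for s
  proof (rule LIMSEQ_le)
    have cont: "isCont f\<^sub>1 q" "isCont f\<^sub>2 q" for q
      using S1.continuous_f S2.continuous_f by (simp_all add: continuous_on_eq_continuous_at)
    show "(\<lambda>k. f\<^sub>2 (X (r k)) + s) \<longlonglongrightarrow> f\<^sub>2 x + s"
      by (intro tendsto_intros isCont_tendsto_compose[OF cont(2)] Xr)
    show "(\<lambda>k. f\<^sub>1 (X (r k) + s *\<^sub>R E (r k))) \<longlonglongrightarrow> f\<^sub>1 (x + s *\<^sub>R e)"
      by (intro isCont_tendsto_compose[OF cont(1)] tendsto_intros Xr Er)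
    obtain m where m: "s \<le> real m" using real_arch_simple by blast
    show "\<exists>m. \<forall>k\<ge>m. f\<^sub>2 (X (r k)) + s \<le> f\<^sub>1 (X (r k) + s *\<^sub>R E (r k))"
    proof (intro exI[of _ m] allI impI)
      fix k assume "m \<le> k"
      then have "s < d (r k)"
        using m X(3)[of "r k"] seq_suble[OF L(2), of k] by linarith
      moreover have "Y (r k) - (X (r k) + s *\<^sub>R E (r k)) = (d (r k) - s) *\<^sub>R E (r k)"
        unfolding YX by (simp add: scaleR_diff_left)
      ultimately have "norm (Y (r k) - (X (r k) + s *\<^sub>R E (r k))) = d (r k) - s"
        using E by simp
      then have "f\<^sub>1 (Y (r k)) - f\<^sub>1 (X (r k) + s *\<^sub>R E (r k)) \<le> d (r k) - s"
        using S1.lipschitz[of "Y (r k)" "X (r k) + s *\<^sub>R E (r k)"] by simp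
      then show "f\<^sub>2 (X (r k)) + s \<le> f\<^sub>1 (X (r k) + s *\<^sub>R E (r k))"
        using X(2)[of "r k"] by linarith
    qed
  qed
  then have "(x, f\<^sub>2 x) \<notin> domain_of_dependence S\<^sub>1"
    by (rule S1.null_ray_leaves_domain_of_dependence[OF e])
  moreover have "(x, f\<^sub>2 x) \<in> S\<^sub>2" by (simp add: S2.graph)
  ultimately show False using dom by blast
qed

lemma continuous_pair:
  "continuous_on UNIV (\<lambda>p. f\<^sub>1 (snd p))" "continuous_on UNIV (\<lambda>p. f\<^sub>2 (fst p))"
  "continuous_on UNIV (\<lambda>p. \<Phi> \<epsilon> x\<^sub>0 (fst p) (snd p))"
proof -
  show 1: "continuous_on UNIV (\<lambda>p. f\<^sub>1 (snd p))"
    by (rule continuous_on_compose2[OF S1.continuous_f]) (auto intro: continuous_intros)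
  show 2: "continuous_on UNIV (\<lambda>p. f\<^sub>2 (fst p))"
    by (rule continuous_on_compose2[OF S2.continuous_f]) (auto intro: continuous_intros)
  have "1 + ((norm (x - x\<^sub>0))\<^sup>2 - (f\<^sub>2 x - f\<^sub>2 x\<^sub>0)\<^sup>2) \<noteq> 0" for x
    using S2.z_nonneg[of x\<^sub>0 x] by (simp add: S2.z_def)
  then show "continuous_on UNIV (\<lambda>p. \<Phi> \<epsilon> x\<^sub>0 (fst p) (snd p))"
    unfolding \<Phi>_def S2.z_def
    by (intro continuous_intros 1 2) auto
qed

lemma eventually_in_cone:
  assumes "norm (y - x) < f\<^sub>1 y - f\<^sub>2 x"
  shows "\<forall>\<^sub>F t in at 0. norm (y + t *\<^sub>R u - (x + t *\<^sub>R v)) < f\<^sub>1 (y + t *\<^sub>R u) - f\<^sub>2 (x + t *\<^sub>R v)"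
proof -
  have cont: "isCont f\<^sub>1 q" "isCont f\<^sub>2 q" for q
    using S1.continuous_f S2.continuous_f by (simp_all add: continuous_on_eq_continuous_at)
  have lim: "((\<lambda>t. q + t *\<^sub>R w) \<longlongrightarrow> q) (at 0)" for q w :: "real ^ 'n"
    by (auto intro!: tendsto_eq_intros)
  have "((\<lambda>t. f\<^sub>1 (y + t *\<^sub>R u) - f\<^sub>2 (x + t *\<^sub>R v) - norm (y + t *\<^sub>R u - (x + t *\<^sub>R v)))
      \<longlongrightarrow> f\<^sub>1 y - f\<^sub>2 x - norm (y - x)) (at 0)"
    by (intro tendsto_diff tendsto_norm lim isCont_tendsto_compose[OF cont(1)]
        isCont_tendsto_compose[OF cont(2)])
  from order_tendstoD(1)[OF this, of 0] assms show ?thesis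
    by (simp add: less_diff_eq)
qed

text \<open>The farthest point of \<open>S\<^sub>1\<close> in the future of a given point exists by compactness, and focusing
  bounds its distance.\<close>
lemma timelike_separation_le:
  assumes dom: "S\<^sub>2 \<subseteq> domain_of_dependence S\<^sub>1" and H: "H > 0" "\<forall>p\<in>S\<^sub>1. H \<le> mean_curvature S\<^sub>1 p"
    and cone: "norm (y - x) \<le> f\<^sub>1 y - f\<^sub>2 x"
  shows "(f\<^sub>1 y - f\<^sub>2 x)\<^sup>2 - (norm (y - x))\<^sup>2 \<le> (1 / H)\<^sup>2"
proof -
  let ?W = "\<lambda>y. (f\<^sub>1 y - f\<^sub>2 x)\<^sup>2 - (norm (y - x))\<^sup>2"
  let ?K = "{y. norm (y - x) \<le> f\<^sub>1 y - f\<^sub>2 x}"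
  have "bounded ?K"
    by (rule bounded_subset[OF bounded_snd[OF cone_bounded[OF dom compact_sing[of x]]]]) force
  moreover have "closed ?K"
    by (intro closed_Collect_le continuous_intros S1.continuous_f)
  ultimately have "compact ?K" by (simp add: compact_eq_bounded_closed)
  moreover have "continuous_on ?K ?W"
    by (intro continuous_intros continuous_on_subset[OF S1.continuous_f]) auto
  ultimately obtain q where q: "q \<in> ?K" "\<And>y. y \<in> ?K \<Longrightarrow> ?W y \<le> ?W q"
    using continuous_attains_sup[of ?K ?W] cone by blast
  show ?thesis
  proof (cases "?W q \<le> 0")
    case True
    moreover have "?W y \<le> ?W q" using q(2) cone by simp
    moreover have "0 \<le> (1 / H)\<^sup>2" by simp
    ultimately show ?thesis by linarith
  next
    case False
    define \<tau> where "\<tau> = (f\<^sub>1 q - f\<^sub>2 x) / S1.w q"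
    have q1: "norm (q - x) < f\<^sub>1 q - f\<^sub>2 x"
    proof -
      have "(norm (q - x))\<^sup>2 < (f\<^sub>1 q - f\<^sub>2 x)\<^sup>2" using False by simp
      moreover have "0 \<le> f\<^sub>1 q - f\<^sub>2 x" 
        using order_trans[OF norm_ge_zero, of "q - x" "f\<^sub>1 q - f\<^sub>2 x"] q(1) by simp
      ultimately show ?thesis by (rule power2_less_imp_less)
    qed
    have "\<forall>\<^sub>F t in at 0. \<Phi> 0 x x (q + t *\<^sub>R u) \<le> \<Phi> 0 x x q" for u
      using eventually_in_cone[OF q1, of u 0]
      by (rule eventually_mono) (use q(2) in \<open>simp add: \<Phi>_def\<close>)
    note bound = timelike_separation_bound[OF this, folded \<tau>_def]
    have "\<tau> > 0" using q1 S1.w_pos[of q] norm_ge_zero[of "q - x"] unfolding \<tau>_def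
      by (intro divide_pos_pos) linarith+
    then have "\<tau> * H \<le> \<tau> * mean_curvature S\<^sub>1 (q, f\<^sub>1 q)"
      using bspec[OF H(2), of "(q, f\<^sub>1 q)"] by (intro mult_left_mono) (auto simp: S1.graph)
    then have "\<tau> * H \<le> 1" using bound(2) by linarith
    then have "\<tau> \<le> 1 / H" using H(1) by (simp add: pos_le_divide_eq)
    then have "\<tau>\<^sup>2 \<le> (1 / H)\<^sup>2" using \<open>\<tau> > 0\<close> by (intro power_mono) auto
    then show ?thesis using bound(1) q(2)[of y] cone by simp
  qed
qed

text \<open>Along a maximising sequence the squared distance is at most \<open>1/H\<^sup>2\<close>, so the penalty is bounded
  and \<open>x\<close> stays in a compact set by properness of \<open>z\<close>; then so does \<open>y\<close>.  The value at \<open>(x\<^sub>0, x\<^sub>0)\<close> is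
  positive, and therefore the maximum is attained at a pair with timelike separation, where all
  small variations are admissible.\<close>
lemma penalised_maximum:
  assumes dom: "S\<^sub>2 \<subseteq> domain_of_dependence S\<^sub>1" and H: "H > 0" "\<forall>p\<in>S\<^sub>1. H \<le> mean_curvature S\<^sub>1 p"
    and below: "f\<^sub>2 x\<^sub>0 < f\<^sub>1 x\<^sub>0" and "\<epsilon> > 0"
  shows "\<exists>x y. norm (y - x) < f\<^sub>1 y - f\<^sub>2 x \<and>
    (f\<^sub>1 x\<^sub>0 - f\<^sub>2 x\<^sub>0)\<^sup>2 \<le> (f\<^sub>1 y - f\<^sub>2 x)\<^sup>2 - (norm (y - x))\<^sup>2 \<and>
    (\<forall>u v. \<forall>\<^sub>F t in at 0. \<Phi> \<epsilon> x\<^sub>0 (x + t *\<^sub>R v) (y + t *\<^sub>R u) \<le> \<Phi> \<epsilon> x\<^sub>0 x y)"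
proof -
  define h where "h = f\<^sub>1 x\<^sub>0 - f\<^sub>2 x\<^sub>0"
  define K where "K = {p. norm (snd p - fst p) \<le> f\<^sub>1 (snd p) - f\<^sub>2 (fst p) \<and> h\<^sup>2 \<le> \<Phi> \<epsilon> x\<^sub>0 (fst p) (snd p)}"
  have start: "\<Phi> \<epsilon> x\<^sub>0 x\<^sub>0 x\<^sub>0 = h\<^sup>2" by (simp add: \<Phi>_def S2.z_def h_def)
  have pen: "\<Phi> \<epsilon> x\<^sub>0 x y \<le> (f\<^sub>1 y - f\<^sub>2 x)\<^sup>2 - (norm (y - x))\<^sup>2" for x y
    using S2.z_nonneg[of x\<^sub>0 x] \<open>\<epsilon> > 0\<close> by (simp add: \<Phi>_def)
  obtain c where c: "c > 0" "\<And>x. norm (x - x\<^sub>0) \<ge> 1 \<Longrightarrow> c * norm (x - x\<^sub>0) \<le> S2.z x\<^sub>0 x"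
    using S2.z_proper by blast
  define r where "r = max 1 (exp ((1 / H)\<^sup>2 / \<epsilon>) / c)"
  have "fst p \<in> cball x\<^sub>0 r" if "p \<in> K" for p
  proof -
    obtain x y where p: "p = (x, y)" by (cases p)
    have "norm (y - x) \<le> f\<^sub>1 y - f\<^sub>2 x" "h\<^sup>2 \<le> \<Phi> \<epsilon> x\<^sub>0 x y"
      using that by (auto simp: K_def p)
    moreover from this(2) have "0 \<le> \<Phi> \<epsilon> x\<^sub>0 x y" using zero_le_power2 by (rule order_trans[rotated])
    ultimately have "\<epsilon> * ln (1 + S2.z x\<^sub>0 x) \<le> (1 / H)\<^sup>2"
      using timelike_separation_le[OF dom H, of y x] by (simp add: \<Phi>_def)
    then have "ln (1 + S2.z x\<^sub>0 x) \<le> (1 / H)\<^sup>2 / \<epsilon>"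
      using \<open>\<epsilon> > 0\<close> by (simp add: pos_le_divide_eq mult.commute)
    then have "exp (ln (1 + S2.z x\<^sub>0 x)) \<le> exp ((1 / H)\<^sup>2 / \<epsilon>)" by simp
    moreover have "exp (ln (1 + S2.z x\<^sub>0 x)) = 1 + S2.z x\<^sub>0 x"
      using S2.z_nonneg[of x\<^sub>0 x] by (intro exp_ln) simp
    ultimately have z: "S2.z x\<^sub>0 x \<le> exp ((1 / H)\<^sup>2 / \<epsilon>)" by linarith
    have "norm (x - x\<^sub>0) \<le> r"
    proof (cases "norm (x - x\<^sub>0) \<ge> 1")
      case True
      then have "norm (x - x\<^sub>0) * c \<le> exp ((1 / H)\<^sup>2 / \<epsilon>)" using order_trans[OF c(2)[OF True] z] by (simp add: mult.commute)
      then have "norm (x - x\<^sub>0) \<le> exp ((1 / H)\<^sup>2 / \<epsilon>) / c" using c(1) by (simp add: pos_le_divide_eq)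
      then show ?thesis by (simp add: r_def)
    qed (simp add: r_def)
    then show ?thesis by (simp add: p dist_norm norm_minus_commute)
  qed
  then have "K \<subseteq> {(x, y). x \<in> cball x\<^sub>0 r \<and> norm (y - x) \<le> f\<^sub>1 y - f\<^sub>2 x}"
    by (auto simp: K_def)
  then have "bounded K"
    using cone_bounded[OF dom compact_cball] bounded_subset by blast
  moreover have "closed K"
    unfolding K_def
    by (intro closed_Collect_conj closed_Collect_le continuous_pair continuous_intros)
  ultimately have compact: "compact K" by (simp add: compact_eq_bounded_closed)
  have "(x\<^sub>0, x\<^sub>0) \<in> K" using below start by (simp add: K_def)
  then have nonempty: "K \<noteq> {}" by blast
  have "continuous_on K (\<lambda>p. \<Phi> \<epsilon> x\<^sub>0 (fst p) (snd p))"
    by (rule continuous_on_subset[OF continuous_pair(3)]) simp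
  from continuous_attains_sup[OF compact nonempty this] obtain p where p: "p \<in> K"
    "\<forall>q\<in>K. \<Phi> \<epsilon> x\<^sub>0 (fst q) (snd q) \<le> \<Phi> \<epsilon> x\<^sub>0 (fst p) (snd p)"
    by (rule bexE)
  define x y where "x = fst p" and "y = snd p"
  have xy: "norm (y - x) \<le> f\<^sub>1 y - f\<^sub>2 x" "h\<^sup>2 \<le> \<Phi> \<epsilon> x\<^sub>0 x y" using p(1) by (auto simp: K_def x_def y_def)
  then have W: "h\<^sup>2 \<le> (f\<^sub>1 y - f\<^sub>2 x)\<^sup>2 - (norm (y - x))\<^sup>2" using pen[of x y] by linarith
  have "h > 0" using below by (simp add: h_def)
  then have "h\<^sup>2 > 0" by simp
  then have "(norm (y - x))\<^sup>2 < (f\<^sub>1 y - f\<^sub>2 x)\<^sup>2" using W by linarith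
  moreover have "0 \<le> f\<^sub>1 y - f\<^sub>2 x" using xy(1) norm_ge_zero[of "y - x"] by linarith
  ultimately have cone: "norm (y - x) < f\<^sub>1 y - f\<^sub>2 x" by (rule power2_less_imp_less)
  have "\<forall>\<^sub>F t in at 0. \<Phi> \<epsilon> x\<^sub>0 (x + t *\<^sub>R v) (y + t *\<^sub>R u) \<le> \<Phi> \<epsilon> x\<^sub>0 x y" for u v
    using eventually_in_cone[OF cone, of u v]
  proof (rule eventually_mono)
    fix t assume t: "norm (y + t *\<^sub>R u - (x + t *\<^sub>R v)) < f\<^sub>1 (y + t *\<^sub>R u) - f\<^sub>2 (x + t *\<^sub>R v)"
    show "\<Phi> \<epsilon> x\<^sub>0 (x + t *\<^sub>R v) (y + t *\<^sub>R u) \<le> \<Phi> \<epsilon> x\<^sub>0 x y"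
    proof (cases "h\<^sup>2 \<le> \<Phi> \<epsilon> x\<^sub>0 (x + t *\<^sub>R v) (y + t *\<^sub>R u)")
      case True
      then have "(x + t *\<^sub>R v, y + t *\<^sub>R u) \<in> K" using t by (simp add: K_def)
      from bspec[OF p(2) this] show ?thesis by (simp add: x_def y_def)
    next
      case False
      then show ?thesis using xy(2) by linarith
    qed
  qed
  then show ?thesis using cone W unfolding h_def by blast
qed

lemma comparison:
  assumes dom: "S\<^sub>2 \<subseteq> domain_of_dependence S\<^sub>1" and H: "H\<^sub>1 > 0" "\<forall>p\<in>S\<^sub>1. H\<^sub>1 \<le> mean_curvature S\<^sub>1 p"
    and H\<^sub>2: "\<forall>p\<in>S\<^sub>2. mean_curvature S\<^sub>2 p = H\<^sub>2" and "H\<^sub>2 \<le> H\<^sub>1"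
  shows "f\<^sub>1 x \<le> f\<^sub>2 x"
proof (rule ccontr)
  assume "\<not> f\<^sub>1 x \<le> f\<^sub>2 x"
  then have below: "f\<^sub>2 x < f\<^sub>1 x" by simp
  define h n where "h = f\<^sub>1 x - f\<^sub>2 x" and "n = real CARD('n)"
  have pos: "h > 0" "n > 0" using below by (auto simp: h_def n_def)
  define \<epsilon>1 \<epsilon>2 where "\<epsilon>1 = 2 * h / (n * \<bar>H\<^sub>2\<bar> + 1)"
    and "\<epsilon>2 = 2 * n * (h * H\<^sub>1)\<^sup>2 / (2 * (2 * n + n\<^sup>2 * H\<^sub>2\<^sup>2 / 2))"
  define \<epsilon> where "\<epsilon> = min \<epsilon>1 \<epsilon>2"
  have d: "0 < n * \<bar>H\<^sub>2\<bar> + 1" "0 < 2 * n + n\<^sup>2 * H\<^sub>2\<^sup>2 / 2"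
  proof -
    have "0 \<le> n * \<bar>H\<^sub>2\<bar>" "0 \<le> n\<^sup>2 * H\<^sub>2\<^sup>2 / 2" using pos by auto
    then show "0 < n * \<bar>H\<^sub>2\<bar> + 1" "0 < 2 * n + n\<^sup>2 * H\<^sub>2\<^sup>2 / 2" using pos by linarith+
  qed
  have \<epsilon>: "\<epsilon> > 0" using d pos H(1) by (simp add: \<epsilon>_def \<epsilon>1_def \<epsilon>2_def)
  have small1: "n * \<bar>H\<^sub>2\<bar> * \<epsilon> \<le> 2 * h"
  proof -
    have "\<epsilon> * (n * \<bar>H\<^sub>2\<bar> + 1) \<le> 2 * h"
      using d(1) pos_le_divide_eq[OF d(1), of \<epsilon> "2 * h"] by (simp add: \<epsilon>_def \<epsilon>1_def)
    then show ?thesis using \<epsilon> by (simp add: algebra_simps)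
  qed
  have small2: "\<epsilon> * (2 * n + n\<^sup>2 * H\<^sub>2\<^sup>2 / 2) < 2 * n * (h * H\<^sub>1)\<^sup>2"
  proof -
    define D where "D = 2 * n + n\<^sup>2 * H\<^sub>2\<^sup>2 / 2"
    have "D > 0" using d(2) by (simp add: D_def)
    have "\<epsilon> \<le> 2 * n * (h * H\<^sub>1)\<^sup>2 / (2 * D)" by (simp add: \<epsilon>_def \<epsilon>2_def D_def)
    then have "\<epsilon> * (2 * D) \<le> 2 * n * (h * H\<^sub>1)\<^sup>2"
      using \<open>D > 0\<close> by (subst (asm) pos_le_divide_eq) auto
    moreover have "\<epsilon> * D > 0" using \<epsilon> \<open>D > 0\<close> by simp
    ultimately show ?thesis unfolding D_def[symmetric] by (simp add: algebra_simps)
  qed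
  obtain p q where cone: "norm (q - p) < f\<^sub>1 q - f\<^sub>2 p"
    and W: "h\<^sup>2 \<le> (f\<^sub>1 q - f\<^sub>2 p)\<^sup>2 - (norm (q - p))\<^sup>2"
    and max: "\<forall>u v. \<forall>\<^sub>F t in at 0. \<Phi> \<epsilon> x (p + t *\<^sub>R v) (q + t *\<^sub>R u) \<le> \<Phi> \<epsilon> x p q"
    using penalised_maximum[OF dom H below \<epsilon>, folded h_def] by (elim exE conjE) (rule that; assumption)
  define \<tau> e where "\<tau> = (f\<^sub>1 q - f\<^sub>2 p) / S1.w q" and "e = \<epsilon> / (1 + S2.z x p)"
  obtain c \<omega> where c: "c \<ge> 1" and \<tau>2: "(f\<^sub>1 q - f\<^sub>2 p)\<^sup>2 - (norm (q - p))\<^sup>2 = \<tau>\<^sup>2"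
    and tang: "e\<^sup>2 * (S2.z x p + \<omega>\<^sup>2) = \<tau>\<^sup>2 * (c\<^sup>2 - 1)"
    and le: "\<And>l. - 2 * n * (l - 1)\<^sup>2 + 4 * l * (c - 1)
        + 2 * n * (\<tau> * l\<^sup>2 * mean_curvature S\<^sub>1 (q, f\<^sub>1 q)
          - (\<tau> * c + e * \<omega>) * mean_curvature S\<^sub>2 (p, f\<^sub>2 p))
        - 2 * n * e + 4 / \<epsilon> * (\<tau>\<^sup>2 * (c\<^sup>2 - 1)) \<le> 0"
    by (rule trace_of_second_variation[OF max[rule_format] \<epsilon>, folded \<tau>_def e_def n_def]) (rule that)
  have "\<tau> > 0" using cone S1.w_pos[of q] norm_ge_zero[of "q - p"] unfolding \<tau>_def
    by (intro divide_pos_pos) linarith+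
  have "h\<^sup>2 \<le> \<tau>\<^sup>2" using W unfolding \<tau>2 .
  then have "h \<le> \<tau>" by (rule power2_le_imp_le) (use \<open>\<tau> > 0\<close> in linarith)
  have "e \<le> \<epsilon>" using \<epsilon> S2.z_nonneg[of x p] by (simp add: e_def divide_le_eq)
  have H1q: "H\<^sub>1 \<le> mean_curvature S\<^sub>1 (q, f\<^sub>1 q)" by (rule bspec[OF H(2)]) (simp add: S1.graph)
  have H2p: "mean_curvature S\<^sub>2 (p, f\<^sub>2 p) = H\<^sub>2" by (rule bspec[OF H\<^sub>2]) (simp add: S2.graph)
  note comparison_arithmetic[OF pos(2,1) H(1) \<epsilon> \<open>H\<^sub>2 \<le> H\<^sub>1\<close> H1q \<open>h \<le> \<tau>\<close> c S2.z_nonneg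
      \<open>e \<le> \<epsilon>\<close> small1 small2 tang refl]
  with le[of "1 + h * H\<^sub>1"] show False unfolding H2p by linarith
qed

end

theorem theorem2p1:
  fixes \<Sigma>\<^sub>1 \<Sigma>\<^sub>2 :: "'n::finite minkowski set" and H\<^sub>1 H\<^sub>2 :: real
  assumes "spacelike_hypersurface \<Sigma>\<^sub>1" and "entire \<Sigma>\<^sub>1"
    and "spacelike_hypersurface \<Sigma>\<^sub>2" and "entire \<Sigma>\<^sub>2"
    and "H\<^sub>1 > 0" and "\<And>p. p \<in> \<Sigma>\<^sub>1 \<Longrightarrow> mean_curvature \<Sigma>\<^sub>1 p \<ge> H\<^sub>1"
    and "\<And>p. p \<in> \<Sigma>\<^sub>2 \<Longrightarrow> mean_curvature \<Sigma>\<^sub>2 p = H\<^sub>2"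
    and "H\<^sub>1 \<ge> H\<^sub>2"
    and "\<Sigma>\<^sub>2 \<subseteq> domain_of_dependence \<Sigma>\<^sub>1"
  shows "\<Sigma>\<^sub>2 \<subseteq> causal_future \<Sigma>\<^sub>1"
proof
  obtain f\<^sub>1 a\<^sub>1 A\<^sub>1 where "spacelike_graph \<Sigma>\<^sub>1 f\<^sub>1 a\<^sub>1 A\<^sub>1"
    using spacelike_graph_exists[OF assms(1,2)] .
  then interpret S1: spacelike_graph \<Sigma>\<^sub>1 f\<^sub>1 a\<^sub>1 A\<^sub>1 .
  obtain f\<^sub>2 a\<^sub>2 A\<^sub>2 where "spacelike_graph \<Sigma>\<^sub>2 f\<^sub>2 a\<^sub>2 A\<^sub>2"
    using spacelike_graph_exists[OF assms(3,4)] .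
  then interpret S2: spacelike_graph \<Sigma>\<^sub>2 f\<^sub>2 a\<^sub>2 A\<^sub>2 .
  interpret spacelike_pair \<Sigma>\<^sub>1 \<Sigma>\<^sub>2 f\<^sub>1 f\<^sub>2 a\<^sub>1 a\<^sub>2 A\<^sub>1 A\<^sub>2 ..
  fix p assume "p \<in> \<Sigma>\<^sub>2"
  then obtain x where p: "p = (x, f\<^sub>2 x)" by (auto simp: S2.graph)
  define v :: "'n minkowski" where "v = (0, f\<^sub>2 x - f\<^sub>1 x)"
  have "f\<^sub>1 x \<le> f\<^sub>2 x" using comparison[OF assms(9,5) _ _ assms(8)] assms(6,7) by blast
  then have "v = 0 \<or> future_directed v \<and> (timelike v \<or> null_vector v)"
    by (cases "f\<^sub>1 x = f\<^sub>2 x") (auto simp: v_def future_directed_def timelike_def mink_def zero_prod_def)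
  moreover have "p = (x, f\<^sub>1 x) + v" "(x, f\<^sub>1 x) \<in> \<Sigma>\<^sub>1" by (simp_all add: p v_def S1.graph)
  ultimately show "p \<in> causal_future \<Sigma>\<^sub>1" unfolding causal_future_def by blast
qed

end
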